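(* Let $G$ be a sub-semi-Riemannian $H$-type group with Lie algebra $\mathcal G=V\oplus U$, $\dim V=n$, $\dim U=m$, and let $\gamma(t)=(v(t),u(t))$ be the geodesic of $G$ (i.e. $\nabla_{\dot\gamma}\dot\gamma=0$) with $\gamma(0)=0$ (the identity) and $\dot\gamma(0)=\dot v^0+\dot u^0$, where $\dot v^0\in V$, $\dot u^0\in U$, $\dot u^0\neq 0$. Put $A=\eta j(\dot u^0)$ and $\rho=|\dot u^0|_U$. Then $\gamma$ satisfies $$\ddot v=A\dot v,\qquad \dot u+\tfrac12[\dot v,v]=\dot u^0 .$$ Moreover there exist integers $0\le s\le r$, $\kappa\ge 0$ with $2r+4\kappa=n$, real numbers $\alpha_k,\beta_k$ with $\alpha_k^2+\beta_k^2=\rho^2$ ($k=1,\dots,\kappa$), and a real orthogonal matrix $P$ such that $A=PDP^{-1}$, where $D$ is block-diagonal with $s$ blocks $\begin{pmatrix}0&\rho\\ \rho&0\end{pmatrix}$, then $r-s$ blocks $\begin{pmatrix}0&\rho\\-\rho&0\end{pmatrix}$, then, for $k=1,\dots,\kappa$, the blocks $$\begin{pmatrix}\alpha_k&\beta_k&0&0\\-\beta_k&\alpha_k&0&0\\0&0&-\alpha_k&-\beta_k\\0&0&\beta_k&-\alpha_k\end{pmatrix}.$$ Put $\tilde v=P^{-1}v$, $\dot{\tilde v}^0=P^{-1}\dot v^0$, and denote the coordinates of $\tilde v$ belonging to the $i$-th block ($1\le i\le r$) by $\tilde v_{i_1},\tilde v_{i_2}$ and those belonging to the $k$-th $4\times4$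 block by $\tilde v_{r+k_1},\tilde v_{r+k_2},\tilde v_{r+k_3},\tilde v_{r+k_4}$. Then: (1) for $i=1,\dots,s$: $\tilde v_{i_1}(t)=\frac1\rho\big(\dot{\tilde v}^0_{i_1}\sinh(\rho t)+\dot{\tilde v}^0_{i_2}\cosh(\rho t)-\dot{\tilde v}^0_{i_2}\big)$ and $\tilde v_{i_2}(t)=\frac1\rho\big(\dot{\tilde v}^0_{i_2}\sinh(\rho t)+\dot{\tilde v}^0_{i_1}\cosh(\rho t)-\dot{\tilde v}^0_{i_1}\big)$; (2) for $i=s+1,\dots,r$: $\tilde v_{i_1}(t)=\frac1\rho\big(\dot{\tilde v}^0_{i_1}\sin(\rho t)-\dot{\tilde v}^0_{i_2}\cos(\rho t)+\dot{\tilde v}^0_{i_2}\big)$ and $\tilde v_{i_2}(t)=\frac1\rho\big(\dot{\tilde v}^0_{i_2}\sin(\rho t)+\dot{\tilde v}^0_{i_1}\cos(\rho t)-\dot{\tilde v}^0_{i_1}\big)$; (3) for $k=1,\dots,\kappa$, with $A_k=\frac1{\rho^2}(\alpha_k\dot{\tilde v}^0_{r+k_2}+\beta_k\dot{\tilde v}^0_{r+k_1})$ and $B_k=\frac1{\rho^2}(\alpha_k\dot{\tilde v}^0_{r+k_1}-\beta_k\dot{\tilde v}^0_{r+k_2})$: $$\tilde v_{r+k_1}(t)=A_k\sinh\alpha_kt\sin\beta_kt+B_k\cosh\alpha_kt\cos\beta_kt+B_k\sinh\alpha_kt\cos\beta_kt+A_k\cosh\alpha_kt\sin\beta_kt-B_k,$$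 $$\tilde v_{r+k_2}(t)=-B_k\sinh\alpha_kt\sin\beta_kt+A_k\cosh\alpha_kt\cos\beta_kt+A_k\sinh\alpha_kt\cos\beta_kt-B_k\cosh\alpha_kt\sin\beta_kt-A_k;$$ (4) for $k=1,\dots,\kappa$, with $C_k=\frac1{\rho^2}(\alpha_k\dot{\tilde v}^0_{r+k_4}+\beta_k\dot{\tilde v}^0_{r+k_3})$ and $D_k=\frac1{\rho^2}(\alpha_k\dot{\tilde v}^0_{r+k_3}-\beta_k\dot{\tilde v}^0_{r+k_4})$: $$\tilde v_{r+k_3}(t)=-C_k\sinh\alpha_kt\sin\beta_kt-D_k\cosh\alpha_kt\cos\beta_kt+D_k\sinh\alpha_kt\cos\beta_kt+C_k\cosh\alpha_kt\sin\beta_kt+D_k,$$ $$\tilde v_{r+k_4}(t)=D_k\sinh\alpha_kt\sin\beta_kt-C_k\cosh\alpha_kt\cos\beta_kt+C_k\sinh\alpha_kt\cos\beta_kt-D_k\cosh\alpha_kt\sin\beta_kt+C_k.$$ The vertical part is $$u(t)=\dot u^0t-\frac12\int_0^t[\dot v(\tau),v(\tau)]\,d\tau,\qquad v=P\tilde v .$$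
   Context: $U=\mathbb R^m$ carries a positive definite inner product $\langle\cdot,\cdot\rangle_U$, $|u|_U^2=\langle u,u\rangle_U$. $V=\mathbb R^n$ carries $\langle v,w\rangle_V=w^t\eta v$ with $\eta=\mathrm{diag}(-I_p,I_q)$, $p+q=n$ ($p$ is the index). $j\colon U\to\mathrm{End}(V)$ is a linear map with (i) $j(u)^2=-|u|_U^2I_V$ and (ii) $\langle\eta j(u)v,w\rangle_V=-\langle v,\eta j(u)w\rangle_V$ for all $u\in U$, $v,w\in V$ (equivalently to (ii), $j(u)^t=-j(u)$). A skew-symmetric bilinear bracket $[\cdot,\cdot]\colon V\times V\to U$ is defined by $\langle u,[v,w]\rangle_U=\langle\eta j(u)v,w\rangle_V$. The Lie algebra $\mathcal G=V\oplus U$ has bracket $[v+u,w+r]=[v,w]$ ($v,w\in V$, $u,r\in U$). $G$ is the corresponding simply connected 2-step nilpotent Lie group, identified with $V\oplus U$ via the exponential map, with product $(v,u)(v',u')=(v+v',u+u'+\tfrac12[v,v'])$. $G$ carries the left-invariant (indefinite) metric equal at the identity to the orthogonal sum of $\langle\cdot,\cdot\rangle_V$ and $\langle\cdot,\cdot\rangle_U$; $\nabla$ is its Levi-Civita connection (given by the Koszul formula). $(v(t),u(t))$ are the coordinates of $\gamma(t)$ under the identification $G\cong V\oplus U$. *)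

theory Defs
  imports "HOL-Analysis.Analysis"
begin

section \<open>Semi-Riemannian geometry in a global chart\<close>

text \<open>
  The underlying manifold is a finite-dimensional vector space \<^typ>\<open>'a\<close> covered by one chart, so
  vector fields are maps \<^typ>\<open>'a \<Rightarrow> 'a\<close>, and a metric assigns to every point a bilinear form
  on \<^typ>\<open>'a\<close>.
\<close>

definition vf_bracket :: "('a::euclidean_space \<Rightarrow> 'a) \<Rightarrow> ('a \<Rightarrow> 'a) \<Rightarrow> 'a \<Rightarrow> 'a" where
  "vf_bracket X Y x = frechet_derivative Y (at x) (X x) - frechet_derivative X (at x) (Y x)"

definition koszul ::
    "('a::euclidean_space \<Rightarrow> 'a \<Rightarrow> 'a \<Rightarrow> real) \<Rightarrow> ('a \<Rightarrow> 'a) \<Rightarrow> ('a \<Rightarrow> 'a) \<Rightarrow> ('a \<Rightarrow> 'a) \<Rightarrow> 'a \<Rightarrow> real" where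
  "koszul g X Y Z x =
     frechet_derivative (\<lambda>y. g y (Y y) (Z y)) (at x) (X x)
   + frechet_derivative (\<lambda>y. g y (Z y) (X y)) (at x) (Y x)
   - frechet_derivative (\<lambda>y. g y (X y) (Y y)) (at x) (Z x)
   + g x (vf_bracket X Y x) (Z x)
   - g x (vf_bracket Y Z x) (X x)
   + g x (vf_bracket Z X x) (Y x)"

definition levi_civita ::
    "('a::euclidean_space \<Rightarrow> 'a \<Rightarrow> 'a \<Rightarrow> real) \<Rightarrow> ('a \<Rightarrow> 'a) \<Rightarrow> ('a \<Rightarrow> 'a) \<Rightarrow> 'a \<Rightarrow> 'a" where
  "levi_civita g X Y x =
     (THE W. \<forall>Z. (\<forall>y. Z differentiable (at y)) \<longrightarrow> 2 * g x W (Z x) = koszul g X Y Z x)"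

text \<open>
  Covariant derivative of a vector field \<open>Y\<close> along a curve \<open>c\<close>: writing \<open>Y\<close> in the coordinate
  frame, whose members are the constant vector fields, the Leibniz rule gives the coordinate
  derivative of \<open>Y\<close> plus \<open>\<nabla>\<close> in direction \<open>c'(t)\<close> of the constant field with value \<open>Y t\<close>.
\<close>

definition covariant_derivative_along ::
    "('a::euclidean_space \<Rightarrow> 'a \<Rightarrow> 'a \<Rightarrow> real) \<Rightarrow> (real \<Rightarrow> 'a) \<Rightarrow> (real \<Rightarrow> 'a) \<Rightarrow> real \<Rightarrow> 'a" where
  "covariant_derivative_along g c Y t =
     vector_derivative Y (at t)
     + levi_civita g (\<lambda>_. vector_derivative c (at t)) (\<lambda>_. Y t) (c t)"

definition geodesic_on ::
    "('a::euclidean_space \<Rightarrow> 'a \<Rightarrow> 'a \<Rightarrow> real) \<Rightarrow> real set \<Rightarrow> (real \<Rightarrow> 'a) \<Rightarrow> bool" where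
  "geodesic_on g I c \<longleftrightarrow>
     (\<forall>t\<in>I. c differentiable (at t)
          \<and> (\<lambda>s. vector_derivative c (at s)) differentiable (at t)
          \<and> covariant_derivative_along g c (\<lambda>s. vector_derivative c (at s)) t = 0)"

section \<open>Sub-semi-Riemannian H-type groups\<close>

text \<open>
  A finite type \<^typ>\<open>'n\<close> carries no order. An enumeration \<open>e\<close> of it, a bijection from
  \<open>{..<CARD('n)}\<close>, orders the coordinates of \<^typ>\<open>real^'n\<close>: the coordinate with (zero-based)
  number \<open>a\<close> of \<open>v\<close> is \<open>v $ e a\<close>, and \<open>matrix_of e f\<close> has entry \<open>f a b\<close> in row \<open>a\<close>, column \<open>b\<close>.
\<close>

definition enumeration :: "(nat \<Rightarrow> 'n::finite) \<Rightarrow> bool" where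
  "enumeration e \<longleftrightarrow> bij_betw e {..<CARD('n)} UNIV"

definition matrix_of :: "(nat \<Rightarrow> 'n::finite) \<Rightarrow> (nat \<Rightarrow> nat \<Rightarrow> real) \<Rightarrow> real^'n^'n" where
  "matrix_of e f =
     (\<chi> x y. f (the_inv_into {..<CARD('n)} e x) (the_inv_into {..<CARD('n)} e y))"

definition eta :: "(nat \<Rightarrow> 'n::finite) \<Rightarrow> nat \<Rightarrow> real^'n^'n" where
  "eta e p = matrix_of e (\<lambda>a b. if a = b then (if a < p then - 1 else 1) else 0)"

definition ipV :: "(nat \<Rightarrow> 'n::finite) \<Rightarrow> nat \<Rightarrow> real^'n \<Rightarrow> real^'n \<Rightarrow> real" where
  "ipV e p v w = w \<bullet> (eta e p *v v)"

definition pos_def_inner_product :: "('u::real_vector \<Rightarrow> 'u \<Rightarrow> real) \<Rightarrow> bool" where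
  "pos_def_inner_product f \<longleftrightarrow>
     bilinear f \<and> (\<forall>x y. f x y = f y x) \<and> (\<forall>x. x \<noteq> 0 \<longrightarrow> f x x > 0)"

definition semi_H_type ::
    "(nat \<Rightarrow> 'n::finite) \<Rightarrow> nat \<Rightarrow> (real^'m \<Rightarrow> real^'m \<Rightarrow> real) \<Rightarrow> (real^'m \<Rightarrow> real^'n^'n) \<Rightarrow> bool" where
  "semi_H_type e p ipU j \<longleftrightarrow>
     enumeration e \<and> p \<le> CARD('n) \<and> pos_def_inner_product ipU \<and> linear j
   \<and> (\<forall>u. j u ** j u = - (ipU u u) *\<^sub>R mat 1)
   \<and> (\<forall>u v w. ipV e p (eta e p *v (j u *v v)) w = - ipV e p v (eta e p *v (j u *v w)))"

definition bracketV ::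
    "(nat \<Rightarrow> 'n::finite) \<Rightarrow> nat \<Rightarrow> (real^'m \<Rightarrow> real^'m \<Rightarrow> real) \<Rightarrow> (real^'m \<Rightarrow> real^'n^'n)
      \<Rightarrow> real^'n \<Rightarrow> real^'n \<Rightarrow> real^'m" where
  "bracketV e p ipU j v w =
     (THE z. \<forall>u. ipU u z = ipV e p (eta e p *v (j u *v v)) w)"

definition group_mult ::
    "(nat \<Rightarrow> 'n::finite) \<Rightarrow> nat \<Rightarrow> (real^'m \<Rightarrow> real^'m \<Rightarrow> real) \<Rightarrow> (real^'m \<Rightarrow> real^'n^'n)
      \<Rightarrow> (real^'n) \<times> (real^'m) \<Rightarrow> (real^'n) \<times> (real^'m) \<Rightarrow> (real^'n) \<times> (real^'m)" where
  "group_mult e p ipU j x y =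
     (fst x + fst y, snd x + snd y + (1/2) *\<^sub>R bracketV e p ipU j (fst x) (fst y))"

text \<open>
  Value of the left-invariant metric at \<open>x\<close>: tangent vectors at \<open>x\<close> are moved to the identity by
  the differential of left translation by the group inverse of \<open>x\<close>. This inverse is \<open>- x\<close>,
  because the bracket is skew-symmetric.
\<close>

definition left_translation_to_identity ::
    "(nat \<Rightarrow> 'n::finite) \<Rightarrow> nat \<Rightarrow> (real^'m \<Rightarrow> real^'m \<Rightarrow> real) \<Rightarrow> (real^'m \<Rightarrow> real^'n^'n)
      \<Rightarrow> (real^'n) \<times> (real^'m) \<Rightarrow> (real^'n) \<times> (real^'m) \<Rightarrow> (real^'n) \<times> (real^'m)" where
  "left_translation_to_identity e p ipU j x X =
     frechet_derivative (group_mult e p ipU j (- x)) (at x) X"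

definition left_inv_metric ::
    "(nat \<Rightarrow> 'n::finite) \<Rightarrow> nat \<Rightarrow> (real^'m \<Rightarrow> real^'m \<Rightarrow> real) \<Rightarrow> (real^'m \<Rightarrow> real^'n^'n)
      \<Rightarrow> (real^'n) \<times> (real^'m) \<Rightarrow> (real^'n) \<times> (real^'m) \<Rightarrow> (real^'n) \<times> (real^'m) \<Rightarrow> real" where
  "left_inv_metric e p ipU j x X Y =
     (let X' = left_translation_to_identity e p ipU j x X;
          Y' = left_translation_to_identity e p ipU j x Y
      in ipV e p (fst X') (fst Y') + ipU (snd X') (snd Y'))"

section \<open>The block-diagonal normal form\<close>

text \<open>
  Blocks and rows are numbered from zero: the \<open>i\<close>-th \<open>2 \<times> 2\<close> block (\<open>i < r\<close>) occupies the rows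
  \<open>2 * i\<close> and \<open>2 * i + 1\<close>, and the \<open>k\<close>-th \<open>4 \<times> 4\<close> block occupies \<open>2 * r + 4 * k\<close> to
  \<open>2 * r + 4 * k + 3\<close>.
\<close>

definition block_entry ::
    "real \<Rightarrow> nat \<Rightarrow> nat \<Rightarrow> (nat \<Rightarrow> real) \<Rightarrow> (nat \<Rightarrow> real) \<Rightarrow> nat \<Rightarrow> nat \<Rightarrow> real" where
  "block_entry \<rho> s r \<alpha> \<beta> a b =
     (if a < 2 * r \<and> b < 2 * r \<and> a div 2 = b div 2 then
        (if a div 2 < s
         then [[0, \<rho>],
               [\<rho>, 0]]
         else [[0, \<rho>],
               [- \<rho>, 0]]) ! (a mod 2) ! (b mod 2)
      else if 2 * r \<le> a \<and> 2 * r \<le> b \<and> (a - 2 * r) div 4 = (b - 2 * r) div 4 then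
        (let k = (a - 2 * r) div 4 in
           [[\<alpha> k, \<beta> k, 0, 0],
            [- \<beta> k, \<alpha> k, 0, 0],
            [0, 0, - \<alpha> k, - \<beta> k],
            [0, 0, \<beta> k, - \<alpha> k]]) ! ((a - 2 * r) mod 4) ! ((b - 2 * r) mod 4)
      else 0)"

end

theory Submission
  imports Defs
begin

text \<open>
  The equations of motion. In the global chart the left-invariant metric at \<open>x\<close> is
  \<open>\<langle>a, c\<rangle>\<^sub>V + \<langle>b - [x, a]/2, d - [x, c]/2\<rangle>\<^sub>U\<close> for tangent vectors \<open>(a, b)\<close> and \<open>(c, d)\<close>. It depends on \<open>x\<close>
  only through the left-invariant vertical part \<open>w = b - [x, a]/2\<close>, so for a constant field \<open>(a, b)\<close> the
  Koszul formula collapses to \<open>-2 \<langle>w, [a, c]\<rangle>\<^sub>U\<close> (\<open>koszul_constant\<close>), which determines the Christoffel term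
  (\<open>levi_civita_constant\<close>). Along a geodesic this gives \<open>v'' = \<eta> j(w) v'\<close>, and then \<open>w' = 0\<close> because the
  bracket is skew; hence \<open>w\<close> keeps its initial value \<open>u0\<close> (\<open>geodesic_equations\<close>), which yields both
  equations of motion, and integrating \<open>w = u0\<close> gives the vertical part.

  The normal form. From \<open>j(u0)\<^sup>2 = - \<rho>\<^sup>2\<close> and skewness, \<open>A = \<eta> j(u0)\<close> satisfies \<open>A A\<^sup>t = \<rho>\<^sup>2\<close> and
  \<open>\<eta> A \<eta> = - A\<^sup>t\<close>: it is \<open>\<rho>\<close> times an orthogonal matrix, and \<open>\<eta>\<close> sends an eigenvalue \<open>\<lambda>\<close> to the negative of
  its complex conjugate. The real structure is extracted from the symmetric operator \<open>S = A + A\<^sup>t\<close>. A unit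
  eigenvector \<open>x\<close> of \<open>S\<close>, with eigenvalue \<open>2\<alpha>\<close>, spans with \<open>A x\<close> a line or a plane on which \<open>A\<close> is \<open>\<rho>\<close> times
  an isometry, in the planar case a rotation. As \<open>S\<close> anticommutes with \<open>\<eta>\<close>, the image under \<open>\<eta>\<close> belongs to the eigenvalue \<open>- 2\<alpha>\<close>, and is
  orthogonal to the first space unless \<open>\<alpha> = 0\<close>. The extreme case \<open>\<bar>\<alpha>\<bar> = \<rho>\<close>, the case \<open>\<alpha> = 0\<close> and the generic case
  give the three kinds of blocks (\<open>hyperbolic_block\<close>, \<open>elliptic_block\<close>, \<open>spiral_block\<close>). Splitting off
  orthogonal complements, which inherit all the invariance, decomposes the whole space
  (\<open>block_decomposition\<close>).

  The solutions. In adapted orthonormal coordinates the equation \<open>v'' = A v'\<close> decouples into planar systems;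
  their solutions with given initial data are unique by an energy estimate
  (\<open>planar_second_order_unique\<close>), so it suffices to verify that the stated functions solve them.
\<close>

section \<open>Planar linear systems\<close>

text \<open>
  Multiplying by \<open>exp (- K s)\<close> makes \<open>E\<close> nonincreasing to the right of \<open>0\<close>, multiplying by \<open>exp (K s)\<close>
  makes it nondecreasing to the left of \<open>0\<close>; in both directions it cannot leave \<open>0\<close>.
\<close>

lemma gronwall_zero:
  fixes E E' :: "real \<Rightarrow> real"
  assumes I: "is_interval I" "0 \<in> I" and t: "t \<in> I"
    and deriv: "\<And>s. s \<in> I \<Longrightarrow> (E has_real_derivative E' s) (at s)"
    and bound: "\<And>s. s \<in> I \<Longrightarrow> \<bar>E' s\<bar> \<le> K * E s"
    and nonneg: "\<And>s. s \<in> I \<Longrightarrow> E s \<ge> 0"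
    and zero: "E 0 = 0"
  shows "E t = 0"
proof -
  have seg: "s \<in> I" if "min 0 t \<le> s" "s \<le> max 0 t" for s
    using that I t unfolding is_interval_1 by (metis max_def min_def)
  have d: "((\<lambda>s. E s * exp (c * s)) has_real_derivative (E' s + c * E s) * exp (c * s)) (at s)"
    if "s \<in> I" for s c
    by (rule derivative_eq_intros deriv that refl)+ (simp add: algebra_simps)
  have "E t \<le> 0"
  proof (cases "0 \<le> t")
    case True
    have "E t * exp (- K * t) \<le> E 0 * exp (- K * 0)"
    proof (rule DERIV_nonpos_imp_nonincreasing[OF True])
      fix s assume "0 \<le> s" "s \<le> t"
      then have s: "s \<in> I" using seg True by simp
      have "(E' s + - K * E s) * exp (- K * s) \<le> 0"
        using bound[OF s] by (intro mult_nonpos_nonneg) auto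
      with d[OF s, of "- K"]
      show "\<exists>y. ((\<lambda>s. E s * exp (- K * s)) has_real_derivative y) (at s) \<and> y \<le> 0" by blast
    qed
    then have "E t * exp (- K * t) \<le> 0" by (simp add: zero)
    then show ?thesis by (simp add: mult_le_0_iff)
  next
    case False
    then have le: "t \<le> 0" by simp
    have "E t * exp (K * t) \<le> E 0 * exp (K * 0)"
    proof (rule DERIV_nonneg_imp_nondecreasing[OF le])
      fix s assume "t \<le> s" "s \<le> 0"
      then have s: "s \<in> I" using seg False by simp
      have "(E' s + K * E s) * exp (K * s) \<ge> 0"
        using bound[OF s] by (intro mult_nonneg_nonneg) auto
      with d[OF s, of K]
      show "\<exists>y. ((\<lambda>s. E s * exp (K * s)) has_real_derivative y) (at s) \<and> y \<ge> 0" by blast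
    qed
    then have "E t * exp (K * t) \<le> 0" by (simp add: zero)
    then show ?thesis by (simp add: mult_le_0_iff)
  qed
  with nonneg[OF t] show ?thesis by simp
qed

lemma planar_energy_bound:
  fixes x y :: real
  shows "\<bar>2 * x * (a * x + b * y) + 2 * y * (c * x + d * y)\<bar>
    \<le> 2 * (\<bar>a\<bar> + \<bar>b\<bar> + \<bar>c\<bar> + \<bar>d\<bar>) * (x\<^sup>2 + y\<^sup>2)"
proof -
  have xy: "\<bar>x * y\<bar> \<le> x\<^sup>2 + y\<^sup>2"
  proof -
    have "0 \<le> (\<bar>x\<bar> - \<bar>y\<bar>)\<^sup>2" by simp
    then have "2 * \<bar>x * y\<bar> \<le> x\<^sup>2 + y\<^sup>2" by (simp add: power2_diff abs_mult)
    then show ?thesis using abs_ge_zero[of "x * y"] by linarith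
  qed
  have "2 * x * (a * x + b * y) + 2 * y * (c * x + d * y)
      = 2 * (a * x\<^sup>2 + b * (x * y) + c * (x * y) + d * y\<^sup>2)"
    by (simp add: power2_eq_square algebra_simps)
  then have "\<bar>2 * x * (a * x + b * y) + 2 * y * (c * x + d * y)\<bar>
      = 2 * \<bar>a * x\<^sup>2 + b * (x * y) + c * (x * y) + d * y\<^sup>2\<bar>"
    by (simp only: abs_mult abs_numeral)
  also have "\<dots> \<le> 2 * (\<bar>a * x\<^sup>2\<bar> + \<bar>b * (x * y)\<bar> + \<bar>c * (x * y)\<bar> + \<bar>d * y\<^sup>2\<bar>)"
    by (intro mult_left_mono order_trans[OF abs_triangle_ineq] add_mono order_refl) auto
  also have "\<dots> \<le> 2 * (\<bar>a\<bar> * (x\<^sup>2 + y\<^sup>2) + \<bar>b\<bar> * (x\<^sup>2 + y\<^sup>2) + \<bar>c\<bar> * (x\<^sup>2 + y\<^sup>2) + \<bar>d\<bar> * (x\<^sup>2 + y\<^sup>2))"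
    unfolding abs_mult[of a] abs_mult[of b] abs_mult[of c] abs_mult[of d]
    by (intro mult_left_mono add_mono xy) auto
  finally show ?thesis by (simp add: algebra_simps)
qed

text \<open>
  The velocities of the difference of two solutions form a homogeneous linear system whose squared length
  obeys the differential inequality of \<open>gronwall_zero\<close>; hence the difference is constant.
\<close>

lemma planar_second_order_unique:
  fixes y1 y2 Y1 Y2 z1 z2 Z1 Z2 :: "real \<Rightarrow> real"
  assumes I: "is_interval I" "0 \<in> I" and t: "t \<in> I"
    and y: "\<And>s. s \<in> I \<Longrightarrow> (y1 has_real_derivative Y1 s) (at s)"
           "\<And>s. s \<in> I \<Longrightarrow> (y2 has_real_derivative Y2 s) (at s)"
           "\<And>s. s \<in> I \<Longrightarrow> (Y1 has_real_derivative a * Y1 s + b * Y2 s) (at s)"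
           "\<And>s. s \<in> I \<Longrightarrow> (Y2 has_real_derivative c * Y1 s + d * Y2 s) (at s)"
    and z: "\<And>s. (z1 has_real_derivative Z1 s) (at s)"
           "\<And>s. (z2 has_real_derivative Z2 s) (at s)"
           "\<And>s. (Z1 has_real_derivative a * Z1 s + b * Z2 s) (at s)"
           "\<And>s. (Z2 has_real_derivative c * Z1 s + d * Z2 s) (at s)"
    and init: "y1 0 = z1 0" "y2 0 = z2 0" "Y1 0 = Z1 0" "Y2 0 = Z2 0"
  shows "y1 t = z1 t \<and> y2 t = z2 t"
proof -
  define X1 X2 where "X1 s = Y1 s - Z1 s" and "X2 s = Y2 s - Z2 s" for s
  have dX: "(X1 has_real_derivative a * X1 s + b * X2 s) (at s)"
           "(X2 has_real_derivative c * X1 s + d * X2 s) (at s)" if "s \<in> I" for s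
    unfolding X1_def X2_def
    by (rule derivative_eq_intros y z that refl | simp add: algebra_simps)+
  have X0: "X1 s = 0 \<and> X2 s = 0" if s: "s \<in> I" for s
  proof -
    have "(X1 s)\<^sup>2 + (X2 s)\<^sup>2 = 0"
    proof (rule gronwall_zero[OF I s, where K = "2 * (\<bar>a\<bar> + \<bar>b\<bar> + \<bar>c\<bar> + \<bar>d\<bar>)"])
      show "((\<lambda>s. (X1 s)\<^sup>2 + (X2 s)\<^sup>2) has_real_derivative
          2 * X1 s * (a * X1 s + b * X2 s) + 2 * X2 s * (c * X1 s + d * X2 s)) (at s)"
        if "s \<in> I" for s
        by (rule derivative_eq_intros dX that refl | simp)+
      show "(X1 0)\<^sup>2 + (X2 0)\<^sup>2 = 0" using init by (simp add: X1_def X2_def)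
    qed (use planar_energy_bound in auto)
    then show ?thesis by (simp add: sum_power2_eq_zero_iff)
  qed
  have const: "x t = x 0" if "\<And>s. s \<in> I \<Longrightarrow> (x has_real_derivative 0) (at s)" for x :: "real \<Rightarrow> real"
  proof -
    have "\<exists>k. \<forall>s\<in>I. x s = k"
      by (rule has_field_derivative_zero_constant)
        (use that I in \<open>auto intro: has_field_derivative_at_within simp: is_interval_convex\<close>)
    then show ?thesis using I t by auto
  qed
  have "y1 t - z1 t = y1 0 - z1 0"
    by (rule const) (use y(1) z(1) X0 in \<open>fastforce intro: derivative_eq_intros simp: X1_def\<close>)
  moreover have "y2 t - z2 t = y2 0 - z2 0"
    by (rule const) (use y(2) z(2) X0 in \<open>fastforce intro: derivative_eq_intros simp: X2_def\<close>)
  ultimately show ?thesis using init by simp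
qed

lemma hyperbolic_block_solution:
  fixes y1 y2 Y1 Y2 :: "real \<Rightarrow> real"
  assumes I: "is_interval I" "0 \<in> I" "t \<in> I"
    and y: "\<And>s. s \<in> I \<Longrightarrow> (y1 has_real_derivative Y1 s) (at s)"
           "\<And>s. s \<in> I \<Longrightarrow> (y2 has_real_derivative Y2 s) (at s)"
           "\<And>s. s \<in> I \<Longrightarrow> (Y1 has_real_derivative \<rho> * Y2 s) (at s)"
           "\<And>s. s \<in> I \<Longrightarrow> (Y2 has_real_derivative \<rho> * Y1 s) (at s)"
    and y0: "y1 0 = 0" "y2 0 = 0" and \<rho>: "\<rho> > 0"
  shows "y1 t = 1 / \<rho> * (Y1 0 * sinh (\<rho> * t) + Y2 0 * cosh (\<rho> * t) - Y2 0)
       \<and> y2 t = 1 / \<rho> * (Y2 0 * sinh (\<rho> * t) + Y1 0 * cosh (\<rho> * t) - Y1 0)"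
proof (rule planar_second_order_unique[OF I y(1,2), where a = 0 and b = \<rho> and c = \<rho> and d = 0
      and ?Z1.0 = "\<lambda>s. Y1 0 * cosh (\<rho> * s) + Y2 0 * sinh (\<rho> * s)"
      and ?Z2.0 = "\<lambda>s. Y2 0 * cosh (\<rho> * s) + Y1 0 * sinh (\<rho> * s)"])
  fix s
  show "((\<lambda>s. 1 / \<rho> * (Y1 0 * sinh (\<rho> * s) + Y2 0 * cosh (\<rho> * s) - Y2 0)) has_real_derivative
          Y1 0 * cosh (\<rho> * s) + Y2 0 * sinh (\<rho> * s)) (at s)"
    "((\<lambda>s. 1 / \<rho> * (Y2 0 * sinh (\<rho> * s) + Y1 0 * cosh (\<rho> * s) - Y1 0)) has_real_derivative
          Y2 0 * cosh (\<rho> * s) + Y1 0 * sinh (\<rho> * s)) (at s)"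
    using \<rho> by (auto intro!: derivative_eq_intros simp: field_simps)
  show "((\<lambda>s. Y1 0 * cosh (\<rho> * s) + Y2 0 * sinh (\<rho> * s)) has_real_derivative
          0 * (Y1 0 * cosh (\<rho> * s) + Y2 0 * sinh (\<rho> * s))
          + \<rho> * (Y2 0 * cosh (\<rho> * s) + Y1 0 * sinh (\<rho> * s))) (at s)"
    "((\<lambda>s. Y2 0 * cosh (\<rho> * s) + Y1 0 * sinh (\<rho> * s)) has_real_derivative
          \<rho> * (Y1 0 * cosh (\<rho> * s) + Y2 0 * sinh (\<rho> * s))
          + 0 * (Y2 0 * cosh (\<rho> * s) + Y1 0 * sinh (\<rho> * s))) (at s)"
    by (auto intro!: derivative_eq_intros simp: algebra_simps)
qed (use y y0 in auto)

lemma elliptic_block_solution: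
  fixes y1 y2 Y1 Y2 :: "real \<Rightarrow> real"
  assumes I: "is_interval I" "0 \<in> I" "t \<in> I"
    and y: "\<And>s. s \<in> I \<Longrightarrow> (y1 has_real_derivative Y1 s) (at s)"
           "\<And>s. s \<in> I \<Longrightarrow> (y2 has_real_derivative Y2 s) (at s)"
           "\<And>s. s \<in> I \<Longrightarrow> (Y1 has_real_derivative \<rho> * Y2 s) (at s)"
           "\<And>s. s \<in> I \<Longrightarrow> (Y2 has_real_derivative - \<rho> * Y1 s) (at s)"
    and y0: "y1 0 = 0" "y2 0 = 0" and \<rho>: "\<rho> > 0"
  shows "y1 t = 1 / \<rho> * (Y1 0 * sin (\<rho> * t) - Y2 0 * cos (\<rho> * t) + Y2 0)
       \<and> y2 t = 1 / \<rho> * (Y2 0 * sin (\<rho> * t) + Y1 0 * cos (\<rho> * t) - Y1 0)"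
proof (rule planar_second_order_unique[OF I y(1,2), where a = 0 and b = \<rho> and c = "- \<rho>" and d = 0
      and ?Z1.0 = "\<lambda>s. Y1 0 * cos (\<rho> * s) + Y2 0 * sin (\<rho> * s)"
      and ?Z2.0 = "\<lambda>s. Y2 0 * cos (\<rho> * s) - Y1 0 * sin (\<rho> * s)"])
  fix s
  show "((\<lambda>s. 1 / \<rho> * (Y1 0 * sin (\<rho> * s) - Y2 0 * cos (\<rho> * s) + Y2 0)) has_real_derivative
          Y1 0 * cos (\<rho> * s) + Y2 0 * sin (\<rho> * s)) (at s)"
    "((\<lambda>s. 1 / \<rho> * (Y2 0 * sin (\<rho> * s) + Y1 0 * cos (\<rho> * s) - Y1 0)) has_real_derivative
          Y2 0 * cos (\<rho> * s) - Y1 0 * sin (\<rho> * s)) (at s)"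
    using \<rho> by (auto intro!: derivative_eq_intros simp: field_simps)
  show "((\<lambda>s. Y1 0 * cos (\<rho> * s) + Y2 0 * sin (\<rho> * s)) has_real_derivative
          0 * (Y1 0 * cos (\<rho> * s) + Y2 0 * sin (\<rho> * s))
          + \<rho> * (Y2 0 * cos (\<rho> * s) - Y1 0 * sin (\<rho> * s))) (at s)"
    "((\<lambda>s. Y2 0 * cos (\<rho> * s) - Y1 0 * sin (\<rho> * s)) has_real_derivative
          - \<rho> * (Y1 0 * cos (\<rho> * s) + Y2 0 * sin (\<rho> * s))
          + 0 * (Y2 0 * cos (\<rho> * s) - Y1 0 * sin (\<rho> * s))) (at s)"
    by (auto intro!: derivative_eq_intros simp: algebra_simps)
qed (use y y0 in auto)

text \<open>
  With \<open>z = y1 + \<i> y2\<close> the system is \<open>z'' = (\<alpha> - \<i> \<beta>) z'\<close>, so \<open>z = (exp ((\<alpha> - \<i> \<beta>) t) - 1) z'(0) / (\<alpha> - \<i> \<beta>)\<close>;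
  the quotient \<open>z'(0) / (\<alpha> - \<i> \<beta>)\<close> is \<open>b + \<i> a\<close>.
\<close>

lemma spiral_block_solution:
  fixes y1 y2 Y1 Y2 :: "real \<Rightarrow> real"
  assumes I: "is_interval I" "0 \<in> I" "t \<in> I"
    and y: "\<And>s. s \<in> I \<Longrightarrow> (y1 has_real_derivative Y1 s) (at s)"
           "\<And>s. s \<in> I \<Longrightarrow> (y2 has_real_derivative Y2 s) (at s)"
           "\<And>s. s \<in> I \<Longrightarrow> (Y1 has_real_derivative \<alpha> * Y1 s + \<beta> * Y2 s) (at s)"
           "\<And>s. s \<in> I \<Longrightarrow> (Y2 has_real_derivative - \<beta> * Y1 s + \<alpha> * Y2 s) (at s)"
    and y0: "y1 0 = 0" "y2 0 = 0" 
    and \<rho>: "\<rho> > 0" "\<alpha>\<^sup>2 + \<beta>\<^sup>2 = \<rho>\<^sup>2"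
    and a: "a = 1 / \<rho>\<^sup>2 * (\<alpha> * Y2 0 + \<beta> * Y1 0)"
    and b: "b = 1 / \<rho>\<^sup>2 * (\<alpha> * Y1 0 - \<beta> * Y2 0)"
  shows "y1 t = exp (\<alpha> * t) * (b * cos (\<beta> * t) + a * sin (\<beta> * t)) - b
       \<and> y2 t = exp (\<alpha> * t) * (a * cos (\<beta> * t) - b * sin (\<beta> * t)) - a"
proof -
  \<comment> \<open>The equations for \<open>a\<close> and \<open>b\<close> are inverted, so that the data are expressed without division.\<close>
  have nz: "\<rho>\<^sup>2 \<noteq> 0" using \<rho> by simp
  have "\<alpha> * b + \<beta> * a = (\<alpha>\<^sup>2 + \<beta>\<^sup>2) / \<rho>\<^sup>2 * Y1 0" "\<alpha> * a - \<beta> * b = (\<alpha>\<^sup>2 + \<beta>\<^sup>2) / \<rho>\<^sup>2 * Y2 0"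
    unfolding a b by (simp_all add: power2_eq_square ring_distribs divide_simps)
  then have ab: "Y1 0 = \<alpha> * b + \<beta> * a" "Y2 0 = \<alpha> * a - \<beta> * b"
    using nz \<rho>(2) by simp_all
  let ?Z1 = "\<lambda>s. exp (\<alpha> * s) * ((\<alpha> * b + \<beta> * a) * cos (\<beta> * s) + (\<alpha> * a - \<beta> * b) * sin (\<beta> * s))"
  let ?Z2 = "\<lambda>s. exp (\<alpha> * s) * ((\<alpha> * a - \<beta> * b) * cos (\<beta> * s) - (\<alpha> * b + \<beta> * a) * sin (\<beta> * s))"
  show ?thesis
  proof (rule planar_second_order_unique[OF I y, where ?Z1.0 = ?Z1 and ?Z2.0 = ?Z2])
    fix s
    show "((\<lambda>s. exp (\<alpha> * s) * (b * cos (\<beta> * s) + a * sin (\<beta> * s)) - b) has_real_derivative ?Z1 s) (at s)"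
      "((\<lambda>s. exp (\<alpha> * s) * (a * cos (\<beta> * s) - b * sin (\<beta> * s)) - a) has_real_derivative ?Z2 s) (at s)"
      "(?Z1 has_real_derivative \<alpha> * ?Z1 s + \<beta> * ?Z2 s) (at s)"
      "(?Z2 has_real_derivative - \<beta> * ?Z1 s + \<alpha> * ?Z2 s) (at s)"
      by (auto intro!: derivative_eq_intros simp: algebra_simps)
  qed (use y0 ab in auto)
qed

section \<open>Normal form of the operator\<close>

text \<open>
  The spectral theorem for one eigenvector: a maximiser \<open>x\<close> of the quadratic form of \<open>S\<close> on the unit sphere of
  \<open>W\<close> is an eigenvector, because the first variation in the direction \<open>S x - l x\<close> has to vanish.
\<close>

lemma symmetric_eigenvector:
  fixes S :: "'a::euclidean_space \<Rightarrow> 'a"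
  assumes S: "linear S" and sym: "\<And>x y. S x \<bullet> y = x \<bullet> S y"
    and W: "subspace W" "\<And>x. x \<in> W \<Longrightarrow> S x \<in> W" and nontriv: "w \<in> W" "w \<noteq> 0"
  obtains x l where "x \<in> W" "norm x = 1" "S x = l *\<^sub>R x"
proof -
  interpret S: linear S by (rule S)
  let ?K = "sphere 0 1 \<inter> W"
  have "compact ?K"
    by (intro compact_Int_closed compact_sphere closed_subspace W)
  moreover have "w /\<^sub>R norm w \<in> ?K"
    using nontriv W by (simp add: subspace_scale)
  then have "?K \<noteq> {}" by blast
  moreover have "continuous_on ?K (\<lambda>x. x \<bullet> S x)"
    by (intro continuous_intros linear_continuous_on linear_conv_bounded_linear[THEN iffD1] S)
  ultimately have "\<exists>x\<in>?K. \<forall>y\<in>?K. y \<bullet> S y \<le> x \<bullet> S x"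
    by (rule continuous_attains_sup)
  then obtain x where x: "x \<in> ?K" and max: "\<And>y. y \<in> ?K \<Longrightarrow> y \<bullet> S y \<le> x \<bullet> S x" by blast
  define l where "l = x \<bullet> S x"
  define z where "z = S x - l *\<^sub>R x"
  have xW: "x \<in> W" and nx: "x \<bullet> x = 1" using x by (auto simp: dist_norm norm_eq_1)
  have zW: "z \<in> W" unfolding z_def by (intro subspace_diff subspace_scale W xW)
  have max': "y \<bullet> S y \<le> l * (y \<bullet> y)" if "y \<in> W" for y
  proof (cases "y = 0")
    case False
    have "y /\<^sub>R norm y \<in> ?K" using False that W by (simp add: subspace_scale)
    from max[OF this] have "(y \<bullet> S y) / (norm y)\<^sup>2 \<le> l"
      by (simp add: l_def S.scaleR power2_eq_square divide_inverse mult.commute mult.left_commute)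
    then show ?thesis using False by (simp add: field_simps dot_square_norm)
  qed (simp add: S.zero)
  define c where "c = z \<bullet> S z - l * (z \<bullet> z)"
  \<comment> \<open>Expansion of the maximality condition at \<open>x + t z\<close>; the term of order \<open>0\<close> cancels.\<close>
  have quad: "2 * t * (z \<bullet> z) + t\<^sup>2 * c \<le> 0" for t
  proof -
    let ?y = "x + t *\<^sub>R z"
    have "?y \<in> W" by (intro subspace_add subspace_scale W xW zW)
    from max'[OF this] have "?y \<bullet> S ?y - l * (?y \<bullet> ?y) \<le> 0" by simp
    moreover have "x \<bullet> S z = z \<bullet> S x" by (metis sym inner_commute)
    moreover have "z \<bullet> S x = z \<bullet> z + l * (x \<bullet> z)"
      by (simp add: z_def algebra_simps inner_commute)
    ultimately show ?thesis
      using nx by (simp add: c_def S.add S.scaleR inner_add l_def[symmetric] inner_commute[of z x]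
          algebra_simps power2_eq_square)
  qed
  have "z \<bullet> z = 0"
  proof (rule ccontr)
    assume "z \<bullet> z \<noteq> 0"
    then have pos: "z \<bullet> z > 0" by simp
    define t where "t = (z \<bullet> z) / (\<bar>c\<bar> + 1)"
    have t: "t > 0" using pos by (simp add: t_def add_nonneg_pos)
    have "t * (2 * (z \<bullet> z) + t * c) \<le> 0" using quad[of t] by (simp add: algebra_simps power2_eq_square)
    then have "2 * (z \<bullet> z) + t * c \<le> 0" using t by (simp add: mult_le_0_iff)
    moreover have "t * (\<bar>c\<bar> + 1) = z \<bullet> z" by (simp add: t_def)
    moreover have "- (t * \<bar>c\<bar>) \<le> t * c" using t by (metis abs_ge_minus_self abs_mult abs_of_pos minus_le_iff)
    ultimately show False using t pos by (simp add: algebra_simps)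
  qed
  then have "S x = l *\<^sub>R x" by (simp add: z_def)
  then show thesis using that x by auto
qed

definition orthonormal_list :: "'a::real_inner list \<Rightarrow> bool" where
  "orthonormal_list xs \<longleftrightarrow>
     distinct xs \<and> pairwise orthogonal (set xs) \<and> (\<forall>x\<in>set xs. norm x = 1)"

lemma orthonormal_list_dim:
  fixes xs :: "'a::euclidean_space list"
  assumes "orthonormal_list xs" shows "dim (span (set xs)) = length xs"
proof -
  have "independent (set xs)"
    using assms by (intro pairwise_orthogonal_independent) (auto simp: orthonormal_list_def)
  then show ?thesis
    using assms by (simp add: dim_eq_card_independent distinct_card orthonormal_list_def)
qed

lemma orthonormal_list_append:
  assumes "orthonormal_list xs" "orthonormal_list ys"
    and "\<And>x y. x \<in> set xs \<Longrightarrow> y \<in> set ys \<Longrightarrow> orthogonal x y"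
  shows "orthonormal_list (xs @ ys)"
proof -
  have "set xs \<inter> set ys = {}"
    using assms by (force simp: orthonormal_list_def orthogonal_self)
  then show ?thesis
    using assms unfolding orthonormal_list_def pairwise_def
    by (auto intro: orthogonal_commute[THEN iffD1])
qed

lemma orthonormal_list_mset:
  "mset xs = mset ys \<Longrightarrow> orthonormal_list xs \<Longrightarrow> orthonormal_list ys"
  unfolding orthonormal_list_def by (metis mset_eq_setD mset_eq_imp_distinct_iff)

text \<open>
  In the application \<open>f = A\<^sup>t\<close>, \<open>g = A\<close> and \<open>h = \<eta>\<close>. The role of \<open>f\<close> is given to the transpose because the
  action of \<open>A\<^sup>t\<close> on the columns of \<open>P\<close> is described by the rows of the block matrix, and these rows are
  also the coefficients of the differential equations for the coordinates.
\<close>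

locale twisted_conformal =
  fixes f g h :: "'a::euclidean_space \<Rightarrow> 'a" and \<rho> :: real
  assumes lin_f: "linear f" and lin_g: "linear g" and lin_h: "linear h"
    and adj: "f x \<bullet> y = x \<bullet> g y" 
    and gf: "g (f x) = \<rho>\<^sup>2 *\<^sub>R x" and fg: "f (g x) = \<rho>\<^sup>2 *\<^sub>R x"
    and h_sym: "h x \<bullet> y = x \<bullet> h y" and hh: "h (h x) = x"
    and fh: "f (h x) = - h (g x)"
    and \<rho>: "\<rho> > 0"
begin

sublocale f: linear f by (rule lin_f)
sublocale g: linear g by (rule lin_g)
sublocale h: linear h by (rule lin_h)

lemma gh: "g (h x) = - h (f x)"
proof -
  have "f (h (h x)) = - h (g (h x))" by (rule fh)
  then have "h (f x) = - h (h (g (h x)))" by (simp add: hh h.neg)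
  then show ?thesis by (simp add: hh)
qed

definition hyperbolic :: "'a \<times> 'a \<Rightarrow> bool" where
  "hyperbolic = (\<lambda>(x, y). f x = \<rho> *\<^sub>R y \<and> f y = \<rho> *\<^sub>R x)"

definition elliptic :: "'a \<times> 'a \<Rightarrow> bool" where
  "elliptic = (\<lambda>(x, y). f x = \<rho> *\<^sub>R y \<and> f y = - \<rho> *\<^sub>R x)"

definition spiral :: "real \<times> real \<times> 'a \<times> 'a \<times> 'a \<times> 'a \<Rightarrow> bool" where
  "spiral = (\<lambda>(\<alpha>, \<beta>, x, y, z, w). \<alpha>\<^sup>2 + \<beta>\<^sup>2 = \<rho>\<^sup>2
     \<and> f x = \<alpha> *\<^sub>R x + \<beta> *\<^sub>R y \<and> f y = - \<beta> *\<^sub>R x + \<alpha> *\<^sub>R y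
     \<and> f z = - \<alpha> *\<^sub>R z - \<beta> *\<^sub>R w \<and> f w = \<beta> *\<^sub>R z - \<alpha> *\<^sub>R w)"

definition invariant :: "'a set \<Rightarrow> bool" where
  "invariant W \<longleftrightarrow> subspace W \<and> (\<forall>x\<in>W. f x \<in> W \<and> g x \<in> W \<and> h x \<in> W)"

lemma invariant_span:
  assumes "\<And>x. x \<in> B \<Longrightarrow> f x \<in> span B \<and> g x \<in> span B \<and> h x \<in> span B"
  shows "invariant (span B)"
proof -
  have "k x \<in> span B" if k: "linear k" and kB: "\<And>x. x \<in> B \<Longrightarrow> k x \<in> span B" and x: "x \<in> span B" for k x
  proof -
    have "k ` span B \<subseteq> span B"
      unfolding linear_span_image[OF k, symmetric] by (rule span_minimal) (use kB in auto)
    then show ?thesis using x by blast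
  qed
  then show ?thesis
    unfolding invariant_def using assms lin_f lin_g lin_h by (auto intro: subspace_span)
qed

text \<open>
  The triple \<open>f\<close>, \<open>g\<close>, \<open>h\<close> is closed under taking adjoints, so invariance passes to orthogonal complements.
\<close>

lemma invariant_complement:
  assumes W: "invariant W" and V: "invariant V"
  shows "invariant {y \<in> W. \<forall>x\<in>V. orthogonal x y}"
  unfolding invariant_def
proof (intro conjI ballI)
  show "subspace {y \<in> W. \<forall>x\<in>V. orthogonal x y}"
    using W unfolding invariant_def subspace_def by (auto simp: orthogonal_clauses)
next
  fix y assume "y \<in> {y \<in> W. \<forall>x\<in>V. orthogonal x y}"
  then have y: "y \<in> W" "\<And>x. x \<in> V \<Longrightarrow> x \<bullet> y = 0" by (auto simp: orthogonal_def)
  have "x \<bullet> f y = 0" "x \<bullet> g y = 0" "x \<bullet> h y = 0" if "x \<in> V" for x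
    using that V y(2) adj h_sym unfolding invariant_def by (metis inner_commute)+
  then show "f y \<in> {y \<in> W. \<forall>x\<in>V. orthogonal x y}" "g y \<in> {y \<in> W. \<forall>x\<in>V. orthogonal x y}"
    "h y \<in> {y \<in> W. \<forall>x\<in>V. orthogonal x y}"
    using y(1) W by (auto simp: orthogonal_def invariant_def)
qed

text \<open>
  Here \<open>x\<close> is a genuine eigenvector of \<open>f\<close> and \<open>h x\<close> one for \<open>- \<alpha>\<close>. Passing to
  \<open>(x + h x) / \<surd>2\<close> and \<open>\<plusminus> (x - h x) / \<surd>2\<close> turns the diagonal form into the antidiagonal one.
\<close>

lemma hyperbolic_block:
  assumes W: "invariant W" and x: "x \<in> W" "norm x = 1" and fx: "f x = \<alpha> *\<^sub>R x" and \<alpha>: "\<bar>\<alpha>\<bar> = \<rho>"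
  obtains p q where "hyperbolic (p, q)" "orthonormal_list [p, q]" "{p, q} \<subseteq> W" "invariant (span {p, q})"
proof -
  have xx: "x \<bullet> x = 1" using x by (simp add: norm_eq_1)
  have \<alpha>2: "\<alpha> * \<alpha> = \<rho>\<^sup>2" "\<alpha> \<noteq> 0" using \<alpha> \<rho> by (auto simp: power2_eq_square abs_if split: if_splits)
  have "\<alpha> *\<^sub>R g x = \<alpha> *\<^sub>R (\<alpha> *\<^sub>R x)" using gf[of x] by (simp add: fx g.scaleR \<alpha>2)
  then have gx: "g x = \<alpha> *\<^sub>R x" using \<alpha>2(2) by (rule scaleR_left_imp_eq[rotated])
  have fhx: "f (h x) = - \<alpha> *\<^sub>R h x" by (simp add: fh gx h.scaleR)
  have ghx: "g (h x) = - \<alpha> *\<^sub>R h x" by (simp add: gh fx h.scaleR)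
  have "f x \<bullet> h x = x \<bullet> g (h x)" by (rule adj)
  then have xhx: "x \<bullet> h x = 0" using \<alpha>2(2) by (simp add: fx ghx)
  have hxhx: "h x \<bullet> h x = 1" by (simp add: h_sym hh xx)
  define \<sigma> where "\<sigma> = sgn \<alpha>"
  have \<sigma>: "\<sigma> * \<sigma> = 1" "\<And>c. \<sigma> * (\<sigma> * c) = c" "\<alpha> = \<rho> * \<sigma>" "\<sigma> * \<alpha> = \<rho>" using \<alpha> \<rho> by (auto simp: \<sigma>_def sgn_if split: if_splits)
  define c :: real where "c = 1 / sqrt 2"
  have c: "2 * (c * c) = 1" "c * c = 1 / 2" by (simp_all add: c_def)
  define p q where "p = c *\<^sub>R (x + h x)" and "q = (\<sigma> * c) *\<^sub>R (x - h x)"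
  have fp: "f p = \<rho> *\<^sub>R q" and fq: "f q = \<rho> *\<^sub>R p" and gp: "g p = \<rho> *\<^sub>R q" and gq: "g q = \<rho> *\<^sub>R p"
    by (simp_all add: \<sigma> p_def q_def f.scaleR f.add f.diff g.scaleR g.add g.diff fx gx fhx ghx algebra_simps)
  have hp: "h p = p" and hq: "h q = - q"
    by (simp_all add: p_def q_def h.scaleR h.add h.diff hh algebra_simps)
  have pp: "p \<bullet> p = 1" "q \<bullet> q = 1" "p \<bullet> q = 0"
    using \<sigma> c by (simp_all add: p_def q_def inner_add inner_diff xx hxhx xhx inner_commute[of "h x" x]
        algebra_simps)
  show thesis
  proof (rule that[of p q])
    show "hyperbolic (p, q)" by (simp add: hyperbolic_def fp fq)
    show "orthonormal_list [p, q]"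
      using pp by (auto simp: orthonormal_list_def pairwise_def orthogonal_def norm_eq_1 inner_commute)
    show "{p, q} \<subseteq> W" using W x(1)
      by (auto simp: p_def q_def invariant_def intro!: subspace_scale subspace_add subspace_diff)
    show "invariant (span {p, q})"
      by (rule invariant_span) (auto simp: fp fq gp gq hp hq span_base span_scale span_neg)
  qed
qed

text \<open>
  Since \<open>f g = \<rho>\<^sup>2\<close>, the eigenvector equation amounts to \<open>f\<^sup>2 x = 2\<alpha> f x - \<rho>\<^sup>2 x\<close>: the plane spanned by \<open>x\<close> and
  \<open>f x\<close> is invariant, and Gram-Schmidt in it gives \<open>y\<close>. The length \<open>\<beta>\<close> of \<open>f x - \<alpha> x\<close> is nonzero because
  \<open>\<bar>\<alpha>\<bar> < \<rho>\<close>.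
\<close>

lemma plane_block:
  assumes x: "norm x = 1" and Sx: "f x + g x = (2 * \<alpha>) *\<^sub>R x" and \<alpha>: "\<bar>\<alpha>\<bar> < \<rho>"
  obtains \<beta> y where "\<alpha>\<^sup>2 + \<beta>\<^sup>2 = \<rho>\<^sup>2" "\<beta> > 0" "y = (1 / \<beta>) *\<^sub>R (f x - \<alpha> *\<^sub>R x)"
    "norm y = 1" "x \<bullet> y = 0"
    "f x = \<alpha> *\<^sub>R x + \<beta> *\<^sub>R y" "f y = - \<beta> *\<^sub>R x + \<alpha> *\<^sub>R y"
    "g x = \<alpha> *\<^sub>R x - \<beta> *\<^sub>R y" "g y = \<beta> *\<^sub>R x + \<alpha> *\<^sub>R y"
proof -
  have xx: "x \<bullet> x = 1" using x by (simp add: norm_eq_1)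
  have "\<alpha>\<^sup>2 < \<rho>\<^sup>2" using \<alpha> \<rho> by (metis abs_of_pos power2_abs power_strict_mono abs_ge_zero pos2)
  define \<beta> where "\<beta> = sqrt (\<rho>\<^sup>2 - \<alpha>\<^sup>2)"
  have \<beta>: "\<beta> > 0" and \<beta>2: "\<beta> * \<beta> = \<rho>\<^sup>2 - \<alpha>\<^sup>2" using \<open>\<alpha>\<^sup>2 < \<rho>\<^sup>2\<close> by (simp_all add: \<beta>_def)
  define y where "y = (1 / \<beta>) *\<^sub>R (f x - \<alpha> *\<^sub>R x)"
  have fx: "f x = \<alpha> *\<^sub>R x + \<beta> *\<^sub>R y" using \<beta> by (simp add: y_def)
  have gx: "g x = \<alpha> *\<^sub>R x - \<beta> *\<^sub>R y"
  proof -
    have "g x = (2 * \<alpha>) *\<^sub>R x - f x" using Sx by (simp add: algebra_simps)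
    also have "\<dots> = \<alpha> *\<^sub>R x - \<beta> *\<^sub>R y"
      unfolding fx mult_2 scaleR_add_left by (rule add_diff_cancel_left)
    finally show ?thesis .
  qed
  have \<beta>y: "\<beta> *\<^sub>R f y = \<beta> *\<^sub>R (- \<beta> *\<^sub>R x + \<alpha> *\<^sub>R y)"
  proof -
    have "\<rho>\<^sup>2 *\<^sub>R x = f (g x)" by (simp add: fg)
    then have "\<beta> *\<^sub>R f y = \<alpha> *\<^sub>R f x - \<rho>\<^sup>2 *\<^sub>R x" by (simp add: gx f.diff f.scaleR algebra_simps)
    also have "\<dots> = (\<alpha>\<^sup>2 - \<rho>\<^sup>2) *\<^sub>R x + (\<alpha> * \<beta>) *\<^sub>R y"
      by (simp add: fx algebra_simps power2_eq_square)
    also have "\<dots> = \<beta> *\<^sub>R (- \<beta> *\<^sub>R x + \<alpha> *\<^sub>R y)"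
      using \<beta>2 by (simp add: algebra_simps flip: scaleR_add_left)
    finally show ?thesis .
  qed
  have gy: "\<beta> *\<^sub>R g y = \<beta> *\<^sub>R (\<beta> *\<^sub>R x + \<alpha> *\<^sub>R y)"
  proof -
    have "\<rho>\<^sup>2 *\<^sub>R x = g (f x)" by (simp add: gf)
    then have "\<beta> *\<^sub>R g y = \<rho>\<^sup>2 *\<^sub>R x - \<alpha> *\<^sub>R g x" by (simp add: fx g.add g.scaleR algebra_simps)
    also have "\<dots> = (\<rho>\<^sup>2 - \<alpha>\<^sup>2) *\<^sub>R x + (\<alpha> * \<beta>) *\<^sub>R y"
      by (simp add: gx algebra_simps power2_eq_square)
    also have "\<dots> = \<beta> *\<^sub>R (\<beta> *\<^sub>R x + \<alpha> *\<^sub>R y)"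
      by (simp add: \<beta>2[symmetric] algebra_simps)
    finally show ?thesis .
  qed
  have xfx: "x \<bullet> f x = \<alpha>"
  proof -
    have "x \<bullet> (f x + g x) = 2 * \<alpha>" by (simp add: Sx xx)
    moreover have "x \<bullet> g x = x \<bullet> f x" by (metis adj inner_commute)
    ultimately show ?thesis by (simp add: inner_add)
  qed
  have fxfx: "f x \<bullet> f x = \<rho>\<^sup>2" by (simp add: adj gf xx)
  have xy: "x \<bullet> y = 0" by (simp add: y_def inner_diff xfx xx)
  have "f x \<bullet> f x = \<alpha>\<^sup>2 + \<beta>\<^sup>2 * (y \<bullet> y)"
    by (simp add: fx inner_add xx xy inner_commute[of y x] power2_eq_square algebra_simps)
  then have "\<beta>\<^sup>2 * (y \<bullet> y) = \<rho>\<^sup>2 - \<alpha>\<^sup>2" using fxfx by linarith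
  then have "\<beta> * \<beta> * (y \<bullet> y) = \<beta> * \<beta>" by (simp only: \<beta>2 power2_eq_square[of \<beta>])
  then have "norm y = 1" using \<beta> by (simp add: norm_eq_1)
  moreover have "\<alpha>\<^sup>2 + \<beta>\<^sup>2 = \<rho>\<^sup>2" using \<beta>2 by (simp add: power2_eq_square)
  moreover have "\<beta> \<noteq> 0" using \<beta> by simp
  from scaleR_left_imp_eq[OF this \<beta>y] scaleR_left_imp_eq[OF this gy]
  have "f y = - \<beta> *\<^sub>R x + \<alpha> *\<^sub>R y" "g y = \<beta> *\<^sub>R x + \<alpha> *\<^sub>R y" .
  ultimately show thesis using that[OF _ \<beta> y_def _ xy fx _ gx] by blast
qed

text \<open>
  On the kernel of \<open>f + g\<close> the involution \<open>h\<close> commutes with \<open>f\<close>. So \<open>h\<close> need not move the plane of a vector \<open>x\<close> to an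
  orthogonal one; instead \<open>x\<close> is replaced by an eigenvector of \<open>h\<close>, whose plane is invariant under \<open>h\<close>.
\<close>

lemma elliptic_block:
  assumes W: "invariant W" and x: "x \<in> W" "x \<noteq> 0" and Sx: "f x + g x = 0"
  obtains p q where "elliptic (p, q)" "orthonormal_list [p, q]" "{p, q} \<subseteq> W" "invariant (span {p, q})"
proof -
  obtain z \<sigma> where z: "z \<in> W" "z \<noteq> 0" "f z + g z = 0" and hz: "h z = \<sigma> *\<^sub>R z"
  proof (cases "x + h x = 0")
    case True
    then have "h x = (- 1) *\<^sub>R x" by (simp add: eq_neg_iff_add_eq_0 add.commute)
    then show thesis using that[of x "-1"] x Sx by simp
  next
    case False
    have "f (x + h x) + g (x + h x) = (f x + g x) - h (f x + g x)"
      by (simp add: f.add g.add h.add fh gh)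
    moreover have "h (x + h x) = 1 *\<^sub>R (x + h x)" by (simp add: h.add hh add.commute)
    ultimately show thesis using that[of "x + h x" 1] False x W
      by (auto simp: Sx h.zero invariant_def intro: subspace_add)
  qed
  define p where "p = z /\<^sub>R norm z"
  have p: "norm p = 1" "p \<in> W" using z W by (auto simp: p_def invariant_def intro: subspace_scale)
  have hp: "h p = \<sigma> *\<^sub>R p" by (simp add: p_def h.scaleR hz)
  have "f p + g p = (1 / norm z) *\<^sub>R (f z + g z)"
    by (simp add: p_def f.scaleR g.scaleR scaleR_add_right inverse_eq_divide)
  then have Sp: "f p + g p = (2 * 0) *\<^sub>R p" by (simp add: z)
  obtain \<beta> q where \<beta>: "0\<^sup>2 + \<beta>\<^sup>2 = \<rho>\<^sup>2" "\<beta> > 0" and qp: "q = (1 / \<beta>) *\<^sub>R (f p - 0 *\<^sub>R p)"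
    and q: "norm q = 1" "p \<bullet> q = 0"
    "f p = 0 *\<^sub>R p + \<beta> *\<^sub>R q" "f q = - \<beta> *\<^sub>R p + 0 *\<^sub>R q"
    "g p = 0 *\<^sub>R p - \<beta> *\<^sub>R q" "g q = \<beta> *\<^sub>R p + 0 *\<^sub>R q"
    by (rule plane_block[OF p(1) Sp]) (use \<rho> in simp)
  have \<beta>\<rho>: "\<beta> = \<rho>" using \<beta> \<rho> by (simp add: power2_eq_iff)
  have hq: "h q = \<sigma> *\<^sub>R q"
  proof -
    have "h q = (1 / \<beta>) *\<^sub>R h (f p)" by (simp add: qp h.scaleR)
    also have "h (f p) = - g (h p)" by (simp add: gh)
    also have "\<dots> = \<sigma> *\<^sub>R (\<beta> *\<^sub>R q)" by (simp add: hp g.scaleR q)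
    finally show ?thesis using \<beta> by simp
  qed
  show thesis
  proof (rule that[of p q])
    show "elliptic (p, q)" using q \<beta>\<rho> by (simp add: elliptic_def)
    show "orthonormal_list [p, q]"
      using p q(1,2) by (auto simp: orthonormal_list_def pairwise_def orthogonal_def inner_commute norm_eq_1)
    show "{p, q} \<subseteq> W" using W p(2) qp
      by (auto simp: invariant_def intro!: subspace_scale)
    show "invariant (span {p, q})"
      by (rule invariant_span) (auto simp: q hp hq span_base span_scale span_neg)
  qed
qed

text \<open>
  The symmetric operator \<open>S = f + g\<close> is \<open>2\<alpha>\<close> on the plane of \<open>x\<close> and \<open>- 2\<alpha>\<close> on its image under \<open>h\<close>. These values
  differ, so the two planes are orthogonal, and \<open>f h = - h g\<close> determines \<open>f\<close> on the second plane. The sign in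
  \<open>w = - h y\<close> is the one that produces the prescribed block.
\<close>

lemma spiral_block:
  assumes W: "invariant W" and x: "x \<in> W" "norm x = 1" and Sx: "f x + g x = (2 * \<alpha>) *\<^sub>R x"
    and \<alpha>: "\<bar>\<alpha>\<bar> < \<rho>" "\<alpha> \<noteq> 0"
  obtains \<beta> y z w where "spiral (\<alpha>, \<beta>, x, y, z, w)" "orthonormal_list [x, y, z, w]" 
    "{x, y, z, w} \<subseteq> W" "invariant (span {x, y, z, w})"
proof -
  obtain \<beta> y where \<beta>: "\<alpha>\<^sup>2 + \<beta>\<^sup>2 = \<rho>\<^sup>2" "\<beta> > 0" and yx: "y = (1 / \<beta>) *\<^sub>R (f x - \<alpha> *\<^sub>R x)"
    and y: "norm y = 1" "x \<bullet> y = 0"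
    "f x = \<alpha> *\<^sub>R x + \<beta> *\<^sub>R y" "f y = - \<beta> *\<^sub>R x + \<alpha> *\<^sub>R y"
    "g x = \<alpha> *\<^sub>R x - \<beta> *\<^sub>R y" "g y = \<beta> *\<^sub>R x + \<alpha> *\<^sub>R y"
    by (rule plane_block[OF x(2) Sx \<alpha>(1)])
  define S where "S a = f a + g a" for a
  have S_sym: "S a \<bullet> b = a \<bullet> S b" for a b
    using adj[of a b] adj[of b a] by (simp add: S_def inner_add inner_commute)
  have Sh: "S (h a) = - h (S a)" for a by (simp add: S_def h.add fh gh)
  have Sa: "S a = (2 * \<alpha>) *\<^sub>R a" if "a \<in> {x, y}" for a
    using that by (auto simp: S_def y(3-6) simp flip: scaleR_2 scaleR_scaleR)
  have orth: "a \<bullet> h b = 0" if "a \<in> {x, y}" "b \<in> {x, y}" for a b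
    using S_sym[of a "h b"] Sa[OF that(1)] Sa[OF that(2)] \<alpha>(2) by (simp add: Sh h.scaleR)
  define z w where "z = h x" and "w = - h y"
  have nrm: "x \<bullet> x = 1" "y \<bullet> y = 1" using x y by (simp_all add: norm_eq_1)
  have ip: "z \<bullet> z = 1" "w \<bullet> w = 1" "z \<bullet> w = 0" "x \<bullet> z = 0" "x \<bullet> w = 0" "y \<bullet> z = 0" "y \<bullet> w = 0"
    using orth y(2) by (simp_all add: z_def w_def h_sym hh nrm inner_commute)
  have fz: "f z = - \<alpha> *\<^sub>R z - \<beta> *\<^sub>R w" "f w = \<beta> *\<^sub>R z - \<alpha> *\<^sub>R w"
    "g z = - \<alpha> *\<^sub>R z + \<beta> *\<^sub>R w" "g w = - \<beta> *\<^sub>R z - \<alpha> *\<^sub>R w"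
    by (simp_all add: z_def w_def fh gh y f.neg g.neg h.add h.diff h.scaleR h.neg)
  have hs: "h x = z" "h y = - w" "h z = x" "h w = - y" by (simp_all add: z_def w_def hh h.neg)
  show thesis
  proof (rule that[of \<beta> y z w])
    show "spiral (\<alpha>, \<beta>, x, y, z, w)" using \<beta> y fz by (simp add: spiral_def)
    show "orthonormal_list [x, y, z, w]"
      using nrm ip y(2)
      by (auto simp: orthonormal_list_def pairwise_def orthogonal_def inner_commute norm_eq_1)
    show "{x, y, z, w} \<subseteq> W" using W x(1) yx
      by (auto simp: invariant_def z_def w_def intro!: subspace_scale subspace_diff subspace_neg)
    show "invariant (span {x, y, z, w})"
    proof (rule invariant_span)
      have [simp]: "x \<in> span {x, y, z, w}" "y \<in> span {x, y, z, w}" "z \<in> span {x, y, z, w}"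
        "w \<in> span {x, y, z, w}" by (auto intro: span_base)
      fix a assume "a \<in> {x, y, z, w}"
      then consider "a = x" | "a = y" | "a = z" | "a = w" by blast
      then show "f a \<in> span {x, y, z, w} \<and> g a \<in> span {x, y, z, w} \<and> h a \<in> span {x, y, z, w}"
        by cases (simp_all only: y(3-6) fz hs, auto intro!: span_add span_diff span_scale span_neg)
    qed
  qed
qed

text \<open>
  The three kinds of blocks are kept in separate lists, so that a decomposition found in arbitrary order is
  already sorted as the normal form demands.
\<close>

definition block_vectors ::
  "('a \<times> 'a) list \<Rightarrow> ('a \<times> 'a) list \<Rightarrow> (real \<times> real \<times> 'a \<times> 'a \<times> 'a \<times> 'a) list \<Rightarrow> 'a list" where
  "block_vectors L1 L2 L4 =
     concat (map (\<lambda>(x, y). [x, y]) (L1 @ L2)) @ concat (map (\<lambda>(_, _, x, y, z, w). [x, y, z, w]) L4)"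

text \<open>
  The identity \<open>\<bar>f x - \<alpha> x\<bar>\<^sup>2 = \<rho>\<^sup>2 - \<alpha>\<^sup>2\<close> for a unit vector \<open>x\<close> with \<open>(f + g) x = 2\<alpha> x\<close> gives \<open>\<bar>\<alpha>\<bar> \<le> \<rho>\<close> and
  shows that \<open>x\<close> is an eigenvector of \<open>f\<close> in the extreme case.
\<close>

lemma find_block:
  assumes W: "invariant W" and w: "w \<in> W" "w \<noteq> 0"
  obtains L1 L2 L4 where "\<forall>B\<in>set L1. hyperbolic B" "\<forall>B\<in>set L2. elliptic B" "\<forall>B\<in>set L4. spiral B"
    "block_vectors L1 L2 L4 \<noteq> []" "orthonormal_list (block_vectors L1 L2 L4)"
    "set (block_vectors L1 L2 L4) \<subseteq> W" "invariant (span (set (block_vectors L1 L2 L4)))"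
proof -
  have sub: "subspace W" using W by (simp add: invariant_def)
  obtain x l where x: "x \<in> W" "norm x = 1" and Sx: "f x + g x = l *\<^sub>R x"
  proof (rule symmetric_eigenvector[of "\<lambda>x. f x + g x" W w])
    show "linear (\<lambda>x. f x + g x)" by (intro linear_compose_add lin_f lin_g)
    show "(f x + g x) \<bullet> y = x \<bullet> (f y + g y)" for x y
      using adj[of x y] adj[of y x] by (simp add: inner_add inner_commute)
  qed (use W w in \<open>auto simp: invariant_def intro: subspace_add\<close>)
  define \<alpha> where "\<alpha> = l / 2"
  have Sx: "f x + g x = (2 * \<alpha>) *\<^sub>R x" by (simp add: \<alpha>_def Sx)
  have xx: "x \<bullet> x = 1" using x by (simp add: norm_eq_1)
  have xfx: "x \<bullet> f x = \<alpha>"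
  proof -
    have "x \<bullet> (f x + g x) = 2 * \<alpha>" by (simp add: Sx xx)
    moreover have "x \<bullet> g x = x \<bullet> f x" by (metis adj inner_commute)
    ultimately show ?thesis by (simp add: inner_add)
  qed
  have "(f x - \<alpha> *\<^sub>R x) \<bullet> (f x - \<alpha> *\<^sub>R x) = f x \<bullet> f x - \<alpha>\<^sup>2"
    using xfx by (simp add: inner_diff inner_commute[of "f x" x] xx power2_eq_square)
  then have dev: "(f x - \<alpha> *\<^sub>R x) \<bullet> (f x - \<alpha> *\<^sub>R x) = \<rho>\<^sup>2 - \<alpha>\<^sup>2"
    by (simp add: adj gf xx)
  then have "\<alpha>\<^sup>2 \<le> \<rho>\<^sup>2" by (metis inner_ge_zero diff_ge_0_iff_ge)
  then have "\<bar>\<alpha>\<bar> \<le> \<rho>" using \<rho> by (simp add: abs_le_square_iff[symmetric])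
  then consider "\<bar>\<alpha>\<bar> = \<rho>" | "\<alpha> = 0" | "\<bar>\<alpha>\<bar> < \<rho>" "\<alpha> \<noteq> 0" by linarith
  then show thesis
  proof cases
    case 1
    then have "\<alpha>\<^sup>2 = \<rho>\<^sup>2" by (metis power2_abs)
    then have fx: "f x = \<alpha> *\<^sub>R x" using dev by simp
    obtain p q where "hyperbolic (p, q)" "orthonormal_list [p, q]" "{p, q} \<subseteq> W" "invariant (span {p, q})"
      by (rule hyperbolic_block[OF W x fx 1])
    then show thesis using that[of "[(p, q)]" "[]" "[]"] by (simp add: block_vectors_def)
  next
    case 2
    obtain p q where "elliptic (p, q)" "orthonormal_list [p, q]" "{p, q} \<subseteq> W" "invariant (span {p, q})"
      by (rule elliptic_block[OF W x(1)]) (use x Sx 2 in auto)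
    then show thesis using that[of "[]" "[(p, q)]" "[]"] by (simp add: block_vectors_def)
  next
    case 3
    obtain \<beta> y z w where "spiral (\<alpha>, \<beta>, x, y, z, w)" "orthonormal_list [x, y, z, w]" 
      "{x, y, z, w} \<subseteq> W" "invariant (span {x, y, z, w})"
      by (rule spiral_block[OF W x Sx 3])
    then show thesis using that[of "[]" "[]" "[(\<alpha>, \<beta>, x, y, z, w)]"] by (simp add: block_vectors_def)
  qed
qed

lemma block_decomposition:
  assumes "invariant W"
  shows "\<exists>L1 L2 L4. (\<forall>B\<in>set L1. hyperbolic B) \<and> (\<forall>B\<in>set L2. elliptic B) \<and> (\<forall>B\<in>set L4. spiral B)
    \<and> orthonormal_list (block_vectors L1 L2 L4) \<and> set (block_vectors L1 L2 L4) \<subseteq> W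
    \<and> length (block_vectors L1 L2 L4) = dim W"
  using assms
proof (induction "dim W" arbitrary: W rule: less_induct)
  case less
  have W: "subspace W" using less.prems by (simp add: invariant_def)
  show ?case
  proof (cases "\<exists>w\<in>W. w \<noteq> 0")
    case False
    then have "dim W = 0" using dim_eq_0[of W] by blast
    then show ?thesis
      by (intro exI[of _ "[]"]) (simp add: block_vectors_def orthonormal_list_def)
  next
    case True
    then obtain w where w: "w \<in> W" "w \<noteq> 0" by blast
    obtain L1 L2 L4 where L: "\<forall>B\<in>set L1. hyperbolic B" "\<forall>B\<in>set L2. elliptic B" "\<forall>B\<in>set L4. spiral B"
      and bs: "block_vectors L1 L2 L4 \<noteq> []" "orthonormal_list (block_vectors L1 L2 L4)"
      "set (block_vectors L1 L2 L4) \<subseteq> W" "invariant (span (set (block_vectors L1 L2 L4)))"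
      using find_block[OF less.prems w] .
    define B where "B = span (set (block_vectors L1 L2 L4))"
    define W' where "W' = {y \<in> W. \<forall>x\<in>B. orthogonal x y}"
    have W': "invariant W'" unfolding W'_def B_def by (rule invariant_complement[OF less.prems bs(4)])
    have "B \<subseteq> W" unfolding B_def by (intro span_minimal bs W)
    then have dims: "dim W' + length (block_vectors L1 L2 L4) = dim W"
      using dim_subspace_orthogonal_to_vectors[of B W] W orthonormal_list_dim[OF bs(2)]
      by (simp add: W'_def B_def)
    then have "dim W' < dim W" using bs(1) by (cases "block_vectors L1 L2 L4") auto
    from less.hyps[OF this W'] obtain M1 M2 M4
      where M: "\<forall>B\<in>set M1. hyperbolic B" "\<forall>B\<in>set M2. elliptic B" "\<forall>B\<in>set M4. spiral B"
      and ms: "orthonormal_list (block_vectors M1 M2 M4)" "set (block_vectors M1 M2 M4) \<subseteq> W'"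
        "length (block_vectors M1 M2 M4) = dim W'" by blast
    let ?xs = "block_vectors (L1 @ M1) (L2 @ M2) (L4 @ M4)"
    have perm: "mset (block_vectors L1 L2 L4 @ block_vectors M1 M2 M4) = mset ?xs"
      by (simp add: block_vectors_def)
    have "orthonormal_list ?xs"
    proof (rule orthonormal_list_mset[OF perm], rule orthonormal_list_append[OF bs(2) ms(1)])
      fix x y assume "x \<in> set (block_vectors L1 L2 L4)" "y \<in> set (block_vectors M1 M2 M4)"
      then show "orthogonal x y" using ms(2) by (auto simp: W'_def B_def span_base)
    qed
    moreover have "set ?xs \<subseteq> W"
      using mset_eq_setD[OF perm] bs(3) ms(2) by (auto simp: W'_def)
    moreover have "length ?xs = dim W"
      using mset_eq_length[OF perm] dims ms(3) by simp
    ultimately show ?thesis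
      using L M by (intro exI[of _ "L1 @ M1"] exI[of _ "L2 @ M2"] exI[of _ "L4 @ M4"]) auto
  qed
qed

end

section \<open>Block matrices and adapted bases\<close>

lemma nth_concat_blocks:
  assumes "\<And>x. x \<in> set L \<Longrightarrow> length (F x) = c" "i < length L" "k < c"
  shows "concat (map F L) ! (c * i + k) = F (L ! i) ! k"
  using assms
proof (induction L arbitrary: i)
  case (Cons x L)
  then show ?case by (cases i) (auto simp: nth_append algebra_simps)
qed simp

lemma length_concat_blocks:
  "(\<And>x. x \<in> set L \<Longrightarrow> length (F x) = c) \<Longrightarrow> length (concat (map F L)) = c * length L"
  by (induction L) auto

lemma block_entry_two_row:
  fixes c :: "nat \<Rightarrow> 'a::real_vector"
  assumes i: "i < r" and N: "2 * r \<le> N"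
    and k: "k < 2"
  shows "(\<Sum>b<N. block_entry \<rho> s r \<alpha> \<beta> (2 * i + k) b *\<^sub>R c b) =
    (if k = 0 then \<rho> *\<^sub>R c (2 * i + 1) else (if i < s then \<rho> else - \<rho>) *\<^sub>R c (2 * i))"
proof -
  have "(\<Sum>b<N. block_entry \<rho> s r \<alpha> \<beta> (2 * i + k) b *\<^sub>R c b)
      = (\<Sum>b\<in>{2 * i, 2 * i + 1}. block_entry \<rho> s r \<alpha> \<beta> (2 * i + k) b *\<^sub>R c b)"
  proof (rule sum.mono_neutral_right)
    have "block_entry \<rho> s r \<alpha> \<beta> (2 * i + k) b = 0" if "b \<noteq> 2 * i" "b \<noteq> 2 * i + 1" for b
    proof -
      have "i \<noteq> b div 2" using that by presburger
      then show ?thesis using i k by (simp add: block_entry_def)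
    qed
    then show "\<forall>b\<in>{..<N} - {2 * i, 2 * i + 1}. block_entry \<rho> s r \<alpha> \<beta> (2 * i + k) b *\<^sub>R c b = 0"
      by auto
  qed (use i N in auto)
  also have "k = 0 \<or> k = 1" using k by auto
  then have "(\<Sum>b\<in>{2 * i, 2 * i + 1}. block_entry \<rho> s r \<alpha> \<beta> (2 * i + k) b *\<^sub>R c b) =
    (if k = 0 then \<rho> *\<^sub>R c (2 * i + 1) else (if i < s then \<rho> else - \<rho>) *\<^sub>R c (2 * i))"
    using i by (auto simp: block_entry_def)
  finally show ?thesis .
qed

lemma block_entry_four_row:
  fixes c :: "nat \<Rightarrow> 'a::real_vector"
  assumes i: "i < \<kappa>" and k: "k < 4"
  shows "(\<Sum>b<2 * r + 4 * \<kappa>. block_entry \<rho> s r \<alpha> \<beta> (2 * r + 4 * i + k) b *\<^sub>R c b) =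
    [\<alpha> i *\<^sub>R c (2 * r + 4 * i) + \<beta> i *\<^sub>R c (2 * r + 4 * i + 1),
     - \<beta> i *\<^sub>R c (2 * r + 4 * i) + \<alpha> i *\<^sub>R c (2 * r + 4 * i + 1),
     - \<alpha> i *\<^sub>R c (2 * r + 4 * i + 2) - \<beta> i *\<^sub>R c (2 * r + 4 * i + 3),
     \<beta> i *\<^sub>R c (2 * r + 4 * i + 2) - \<alpha> i *\<^sub>R c (2 * r + 4 * i + 3)] ! k"
proof -
  let ?o = "2 * r + 4 * i"
  have "(\<Sum>b<2 * r + 4 * \<kappa>. block_entry \<rho> s r \<alpha> \<beta> (?o + k) b *\<^sub>R c b)
      = (\<Sum>b\<in>{?o, ?o + 1, ?o + 2, ?o + 3}. block_entry \<rho> s r \<alpha> \<beta> (?o + k) b *\<^sub>R c b)"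
  proof (rule sum.mono_neutral_right)
    have "block_entry \<rho> s r \<alpha> \<beta> (?o + k) b = 0" if "b \<notin> {?o, ?o + 1, ?o + 2, ?o + 3}" for b
    proof -
      have "\<not> (2 * r \<le> b \<and> i = (b - 2 * r) div 4)"
      proof
        assume b: "2 * r \<le> b \<and> i = (b - 2 * r) div 4"
        define m where "m = (b - 2 * r) mod 4"
        have "b - 2 * r = 4 * i + m" using b by (simp add: m_def)
        then have "b = ?o + m" using b by linarith
        moreover have "m < 4" by (simp add: m_def)
        then have "m = 0 \<or> m = 1 \<or> m = 2 \<or> m = 3" by linarith
        ultimately show False using that by auto
      qed
      moreover have "(?o + k - 2 * r) div 4 = i" using k by simp
      ultimately have "\<not> (2 * r \<le> ?o + k \<and> 2 * r \<le> b \<and> (?o + k - 2 * r) div 4 = (b - 2 * r) div 4)"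
        by metis
      moreover have "\<not> (?o + k < 2 * r \<and> b < 2 * r \<and> (?o + k) div 2 = b div 2)" by simp
      ultimately show ?thesis by (simp only: block_entry_def if_False)
    qed
    then show "\<forall>b\<in>{..<2 * r + 4 * \<kappa>} - {?o, ?o + 1, ?o + 2, ?o + 3}.
        block_entry \<rho> s r \<alpha> \<beta> (?o + k) b *\<^sub>R c b = 0"
      by (metis DiffD2 scaleR_zero_left)
    have "?o + 3 < 2 * r + 4 * \<kappa>" using i by linarith
    then show "{?o, ?o + 1, ?o + 2, ?o + 3} \<subseteq> {..<2 * r + 4 * \<kappa>}" by simp
  qed simp
  also have entry: "block_entry \<rho> s r \<alpha> \<beta> (?o + k) (?o + l) =
      [[\<alpha> i, \<beta> i, 0, 0], [- \<beta> i, \<alpha> i, 0, 0], [0, 0, - \<alpha> i, - \<beta> i], [0, 0, \<beta> i, - \<alpha> i]] ! k ! l"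
    if "l < 4" for l
  proof -
    have "(?o + k - 2 * r) div 4 = i" "(?o + k - 2 * r) mod 4 = k"
      "(?o + l - 2 * r) div 4 = i" "(?o + l - 2 * r) mod 4 = l" using that k by simp_all
    moreover have "\<not> ?o + k < 2 * r" "2 * r \<le> ?o + k" "2 * r \<le> ?o + l" by simp_all
    ultimately show ?thesis by (simp only: block_entry_def Let_def simp_thms if_True if_False)
  qed
  have "{?o, ?o + 1, ?o + 2, ?o + 3} = (\<lambda>l. ?o + l) ` {0, 1, 2, 3}" by simp
  then have "(\<Sum>b\<in>{?o, ?o + 1, ?o + 2, ?o + 3}. block_entry \<rho> s r \<alpha> \<beta> (?o + k) b *\<^sub>R c b)
      = (\<Sum>l\<in>{0, 1, 2, 3}. block_entry \<rho> s r \<alpha> \<beta> (?o + k) (?o + l) *\<^sub>R c (?o + l))"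
    by (simp only: sum.reindex inj_on_add o_def)
  also have "\<dots> = (\<Sum>l\<in>{0, 1, 2, 3}.
      [[\<alpha> i, \<beta> i, 0, 0], [- \<beta> i, \<alpha> i, 0, 0], [0, 0, - \<alpha> i, - \<beta> i], [0, 0, \<beta> i, - \<alpha> i]] ! k ! l *\<^sub>R c (?o + l))"
    by (intro sum.cong refl) (auto simp only: entry insert_iff empty_iff)
  also have "\<dots> = [\<alpha> i *\<^sub>R c ?o + \<beta> i *\<^sub>R c (?o + 1), - \<beta> i *\<^sub>R c ?o + \<alpha> i *\<^sub>R c (?o + 1),
     - \<alpha> i *\<^sub>R c (?o + 2) - \<beta> i *\<^sub>R c (?o + 3), \<beta> i *\<^sub>R c (?o + 2) - \<alpha> i *\<^sub>R c (?o + 3)] ! k"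
  proof -
    have "k = 0 \<or> k = 1 \<or> k = 2 \<or> k = 3" using k by linarith
    then show ?thesis by (elim disjE) simp_all
  qed
  finally show ?thesis .
qed

lemma (in twisted_conformal) orthonormal_block_basis:
  obtains s r \<kappa> :: nat and \<alpha> \<beta> :: "nat \<Rightarrow> real" and c :: "nat \<Rightarrow> 'a"
  where "s \<le> r" "2 * r + 4 * \<kappa> = DIM('a)" "\<And>k. k < \<kappa> \<Longrightarrow> (\<alpha> k)\<^sup>2 + (\<beta> k)\<^sup>2 = \<rho>\<^sup>2"
    "\<And>a b. a < DIM('a) \<Longrightarrow> b < DIM('a) \<Longrightarrow> c a \<bullet> c b = (if a = b then 1 else 0)"
    "\<And>a. a < DIM('a) \<Longrightarrow> f (c a) = (\<Sum>b<DIM('a). block_entry \<rho> s r \<alpha> \<beta> a b *\<^sub>R c b)"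
proof -
  have "invariant UNIV" by (simp add: invariant_def)
  from block_decomposition[OF this] obtain L1 L2 L4
    where L1: "\<forall>B\<in>set L1. hyperbolic B" and L2: "\<forall>B\<in>set L2. elliptic B" and L4: "\<forall>B\<in>set L4. spiral B"
      and on: "orthonormal_list (block_vectors L1 L2 L4)"
      and len: "length (block_vectors L1 L2 L4) = DIM('a)"
    by auto
  define s r \<kappa> where "s = length L1" and "r = length (L1 @ L2)" and "\<kappa> = length L4"
  define \<alpha> \<beta> where "\<alpha> k = fst (L4 ! k)" and "\<beta> k = fst (snd (L4 ! k))" for k
  define F2 where "F2 = (\<lambda>(x, y). [x, y :: 'a])"
  define F4 where "F4 = (\<lambda>(_ :: real, _ :: real, x, y, z, w). [x, y, z, w :: 'a])"
  have bv: "block_vectors L1 L2 L4 = concat (map F2 (L1 @ L2)) @ concat (map F4 L4)"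
    by (simp add: block_vectors_def F2_def F4_def)
  define c where "c a = block_vectors L1 L2 L4 ! a" for a
  have len2: "length (concat (map F2 (L1 @ L2))) = 2 * r"
    unfolding r_def by (rule length_concat_blocks) (auto simp: F2_def)
  have len4: "length (concat (map F4 L4)) = 4 * \<kappa>"
    unfolding \<kappa>_def by (rule length_concat_blocks) (auto simp: F4_def)
  have N: "2 * r + 4 * \<kappa> = DIM('a)" using len len2 len4 by (simp add: bv)
  have c2: "c (2 * i + k) = F2 ((L1 @ L2) ! i) ! k" if "i < r" "k < 2" for i k
  proof -
    have "2 * i + k < 2 * r" using that by linarith
    then have "c (2 * i + k) = concat (map F2 (L1 @ L2)) ! (2 * i + k)"
      by (simp only: c_def bv nth_append len2 if_True)
    also have "\<dots> = F2 ((L1 @ L2) ! i) ! k"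
      by (rule nth_concat_blocks) (use that in \<open>auto simp: F2_def r_def\<close>)
    finally show ?thesis .
  qed
  have c4: "c (2 * r + 4 * i + k) = F4 (L4 ! i) ! k" if "i < \<kappa>" "k < 4" for i k
  proof -
    have "c (2 * r + 4 * i + k) = concat (map F4 L4) ! (4 * i + k)"
      by (simp only: c_def bv nth_append len2 add.assoc not_add_less1 if_False add_diff_cancel_left')
    also have "\<dots> = F4 (L4 ! i) ! k"
      by (rule nth_concat_blocks) (use that in \<open>auto simp: F4_def \<kappa>_def\<close>)
    finally show ?thesis .
  qed
  show thesis
  proof (rule that[of s r \<kappa> \<alpha> \<beta> c])
    show "s \<le> r" by (simp add: s_def r_def)
    show "2 * r + 4 * \<kappa> = DIM('a)" by (rule N)
    show "(\<alpha> k)\<^sup>2 + (\<beta> k)\<^sup>2 = \<rho>\<^sup>2" if "k < \<kappa>" for k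
    proof -
      have "spiral (L4 ! k)" using L4 that by (simp add: \<kappa>_def)
      then show ?thesis by (simp add: spiral_def \<alpha>_def \<beta>_def case_prod_beta)
    qed
    show "c a \<bullet> c b = (if a = b then 1 else 0)" if "a < DIM('a)" "b < DIM('a)" for a b
      using on that len unfolding orthonormal_list_def c_def pairwise_def orthogonal_def
      by (auto simp: norm_eq_1 nth_eq_iff_index_eq)
    show "f (c a) = (\<Sum>b<DIM('a). block_entry \<rho> s r \<alpha> \<beta> a b *\<^sub>R c b)" if a: "a < DIM('a)" for a
    proof (cases "a < 2 * r")
      case True
      define i k where "i = a div 2" and "k = a mod 2"
      have ak: "a = 2 * i + k" "k < 2" "i < r" using True by (auto simp: i_def k_def)
      obtain x y where xy: "(L1 @ L2) ! i = (x, y)" by fastforce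
      have c: "c (2 * i) = x" "c (2 * i + 1) = y"
        using c2[OF ak(3), of 0] c2[OF ak(3), of 1] by (simp_all add: xy F2_def)
      have "f x = \<rho> *\<^sub>R y \<and> f y = (if i < s then \<rho> else - \<rho>) *\<^sub>R x"
      proof (cases "i < s")
        case True
        then have "(x, y) \<in> set L1" using xy by (metis nth_append nth_mem s_def)
        then show ?thesis using L1 True by (auto simp: hyperbolic_def)
      next
        case False
        then have "L2 ! (i - s) = (x, y)" "i - s < length L2"
          using xy ak(3) by (auto simp: nth_append s_def r_def)
        then have "(x, y) \<in> set L2" by (metis nth_mem)
        then show ?thesis using L2 False by (auto simp: elliptic_def)
      qed
      moreover have "k = 0 \<or> k = 1" using ak(2) by auto
      ultimately have "f (c a) = (if k = 0 then \<rho> *\<^sub>R c (2 * i + 1) else (if i < s then \<rho> else - \<rho>) *\<^sub>R c (2 * i))"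
        using c ak(1) by auto
      then show ?thesis
        unfolding ak(1) by (subst block_entry_two_row[OF ak(3) _ ak(2)]) (use N in auto)
    next
      case False
      define i k where "i = (a - 2 * r) div 4" and "k = (a - 2 * r) mod 4"
      have ak: "a = 2 * r + 4 * i + k" "k < 4" "i < \<kappa>" using False a N by (auto simp: i_def k_def)
      obtain x y z w where B: "L4 ! i = (\<alpha> i, \<beta> i, x, y, z, w)"
        by (metis \<alpha>_def \<beta>_def prod.collapse)
      have c: "c (2 * r + 4 * i) = x" "c (2 * r + 4 * i + 1) = y" "c (2 * r + 4 * i + 2) = z" "c (2 * r + 4 * i + 3) = w"
        using c4[OF ak(3), of 0] c4[OF ak(3), of 1] c4[OF ak(3), of 2] c4[OF ak(3), of 3] by (simp_all add: B F4_def)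
      have "spiral (\<alpha> i, \<beta> i, x, y, z, w)" using L4 ak(3) B by (metis \<kappa>_def nth_mem)
      then have "f x = \<alpha> i *\<^sub>R x + \<beta> i *\<^sub>R y" "f y = - \<beta> i *\<^sub>R x + \<alpha> i *\<^sub>R y"
        "f z = - \<alpha> i *\<^sub>R z - \<beta> i *\<^sub>R w" "f w = \<beta> i *\<^sub>R z - \<alpha> i *\<^sub>R w" by (simp_all add: spiral_def)
      moreover have "k = 0 \<or> k = 1 \<or> k = 2 \<or> k = 3" using ak(2) by linarith
      ultimately show ?thesis
        unfolding N[symmetric] ak(1) block_entry_four_row[OF ak(3,2)] using c by auto
    qed
  qed
qed

lemma enumeration_sum:
  fixes e :: "nat \<Rightarrow> 'n::finite"
  assumes "enumeration e"
  shows "(\<Sum>x\<in>UNIV. F x) = (\<Sum>a<CARD('n). F (e a))"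
  using sum.reindex_bij_betw[of e "{..<CARD('n)}" UNIV F] assms by (simp add: enumeration_def)

lemma enumeration_index:
  fixes e :: "nat \<Rightarrow> 'n::finite"
  assumes "enumeration e" "a < CARD('n)"
  shows "the_inv_into {..<CARD('n)} e (e a) = a"
  using assms by (simp add: enumeration_def bij_betw_def the_inv_into_f_f)

lemma enumeration_cases:
  fixes e :: "nat \<Rightarrow> 'n::finite"
  assumes "enumeration e"
  obtains a where "a < CARD('n)" "x = e a"
proof -
  have "x \<in> e ` {..<CARD('n)}" using assms by (simp add: enumeration_def bij_betw_def)
  then show thesis using that by auto
qed

lemma matrix_of_vector:
  fixes e :: "nat \<Rightarrow> 'n::finite"
  assumes e: "enumeration e" and a: "a < CARD('n)"
  shows "(matrix_of e F *v x) $ e a = (\<Sum>b<CARD('n). F a b * x $ e b)"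
  by (simp add: matrix_vector_mult_def matrix_of_def enumeration_sum[OF e] enumeration_index[OF e] a)

lemma enumeration_vec_eqI:
  fixes e :: "nat \<Rightarrow> 'n::finite" and x y :: "'b^'n"
  assumes "enumeration e" "\<And>a. a < CARD('n) \<Longrightarrow> x $ e a = y $ e a"
  shows "x = y"
  using assms enumeration_cases[OF assms(1)] by (metis vec_eq_iff)

lemma eta_component:
  fixes e :: "nat \<Rightarrow> 'n::finite"
  assumes e: "enumeration e" and a: "a < CARD('n)"
  shows "(eta e p *v x) $ e a = (if a < p then - 1 else 1) * x $ e a"
proof -
  have "(eta e p *v x) $ e a = (\<Sum>b<CARD('n). if a = b then (if a < p then - 1 else 1) * x $ e b else 0)"
    unfolding eta_def matrix_of_vector[OF e a] by (intro sum.cong) auto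
  then show ?thesis using a by simp
qed

lemma eta_involution:
  fixes e :: "nat \<Rightarrow> 'n::finite"
  assumes e: "enumeration e"
  shows "eta e p *v (eta e p *v x) = x"
  by (rule enumeration_vec_eqI[OF e]) (simp add: eta_component[OF e])

lemma eta_symmetric:
  fixes e :: "nat \<Rightarrow> 'n::finite"
  assumes e: "enumeration e"
  shows "(eta e p *v x) \<bullet> y = x \<bullet> (eta e p *v y)"
  unfolding inner_vec_def enumeration_sum[OF e] by (intro sum.cong) (simp_all add: eta_component[OF e])

lemma orthogonal_matrix_inv:
  fixes P :: "real^'n^'n"
  assumes "orthogonal_matrix P"
  shows "matrix_inv P = transpose P"
  unfolding matrix_inv_def
proof (rule some_equality)
  show "P ** transpose P = mat 1 \<and> transpose P ** P = mat 1"
    using assms by (simp add: orthogonal_matrix_def)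
  fix Q assume "P ** Q = mat 1 \<and> Q ** P = mat 1"
  then show "Q = transpose P"
    using assms unfolding orthogonal_matrix_def
    by (metis matrix_mul_assoc matrix_mul_lid matrix_mul_rid)
qed

lemma orthonormal_enumerated_columns:
  fixes e :: "nat \<Rightarrow> 'n::finite" and c :: "nat \<Rightarrow> real^'n"
  assumes e: "enumeration e"
    and c: "\<And>a b. a < CARD('n) \<Longrightarrow> b < CARD('n) \<Longrightarrow> c a \<bullet> c b = (if a = b then 1 else 0)"
  obtains P :: "real^'n^'n" where "orthogonal_matrix P"
    "\<And>a x. a < CARD('n) \<Longrightarrow> (matrix_inv P *v x) $ e a = c a \<bullet> x"
proof -
  define P :: "real^'n^'n" where "P = (\<chi> x y. c (the_inv_into {..<CARD('n)} e y) $ x)"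
  have Pt: "(transpose P *v x) $ e a = c a \<bullet> x" if "a < CARD('n)" for a x
    using that by (simp add: P_def matrix_vector_mult_def transpose_def inner_vec_def enumeration_index[OF e])
  have "transpose P ** P = mat 1"
  proof -
    have "(transpose P ** P) $ e a $ e b = (mat 1 :: real^'n^'n) $ e a $ e b" if "a < CARD('n)" "b < CARD('n)" for a b
    proof -
      have "(transpose P ** P) $ e a $ e b = c a \<bullet> c b"
        using that by (simp add: P_def matrix_matrix_mult_def transpose_def inner_vec_def enumeration_index[OF e])
      moreover have "e a = e b \<longleftrightarrow> a = b"
        using enumeration_index[OF e] that by metis
      ultimately show ?thesis using that by (simp add: c mat_def)
    qed
    then show ?thesis by (intro enumeration_vec_eqI[OF e])
  qed
  then have P: "orthogonal_matrix P" by (simp add: orthogonal_matrix)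
  moreover have "matrix_inv P = transpose P"
    using P by (rule orthogonal_matrix_inv)
  ultimately show thesis using that Pt by metis
qed

lemma minus_matrix_vector_mult: "(- A) *v x = - (A *v x)" for A :: "real^'n^'m"
  by (simp add: vec_eq_iff matrix_vector_mult_def sum_negf)

text \<open>
  Both \<open>\<eta>\<close> and \<open>J\<close> are orthogonal up to a factor, and \<open>A\<^sup>t = - J \<eta>\<close>; all the relations follow by cancelling
  \<open>\<eta>\<^sup>2 = 1\<close> and \<open>J\<^sup>2 = - \<rho>\<^sup>2\<close>.
\<close>

lemma twisted_conformal_matrix:
  fixes J :: "real^'n^'n"
  assumes e: "enumeration e" and skew: "transpose J = - J" and sq: "J ** J = - (\<rho>\<^sup>2) *\<^sub>R mat 1" and \<rho>: "\<rho> > 0"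
  shows "twisted_conformal (\<lambda>x. transpose (eta e p ** J) *v x) (\<lambda>x. (eta e p ** J) *v x) (\<lambda>x. eta e p *v x) \<rho>"
proof -
  have JJ: "J *v (J *v x) = - (\<rho>\<^sup>2) *\<^sub>R x" for x
    unfolding matrix_vector_mul_assoc sq
    by (simp only: scaleR_matrix_vector_assoc[symmetric] matrix_vector_mul_lid)
  have T: "transpose (eta e p ** J) *v x = - (J *v (eta e p *v x))" for x
  proof (rule vector_eq_ldot[THEN iffD1], rule allI)
    fix z
    have "z \<bullet> (transpose (eta e p ** J) *v x) = ((eta e p ** J) *v z) \<bullet> x"
      by (simp only: transpose_matrix_vector inner_commute[of z] dot_lmul_matrix) (rule inner_commute)
    also have "\<dots> = (J *v z) \<bullet> (eta e p *v x)"
      by (simp add: eta_symmetric[OF e] flip: matrix_vector_mul_assoc)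
    also have "\<dots> = z \<bullet> (transpose J *v (eta e p *v x))"
      by (simp only: transpose_matrix_vector inner_commute[of z] dot_lmul_matrix) (rule inner_commute)
    finally show "z \<bullet> (transpose (eta e p ** J) *v x) = z \<bullet> (- (J *v (eta e p *v x)))"
      by (simp add: skew minus_matrix_vector_mult)
  qed
  show ?thesis
  proof (rule twisted_conformal.intro)
    show "(transpose (eta e p ** J) *v x) \<bullet> y = x \<bullet> ((eta e p ** J) *v y)" for x y
      by (simp only: transpose_matrix_vector dot_lmul_matrix)
    show "linear (\<lambda>x. transpose (eta e p ** J) *v x)" "linear (\<lambda>x. (eta e p ** J) *v x)"
      "linear (\<lambda>x. eta e p *v x)" by (rule matrix_vector_mul_linear)+
    show "\<rho> > 0" by (rule \<rho>)
    fix x y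
    show "(eta e p *v x) \<bullet> y = x \<bullet> (eta e p *v y)" by (rule eta_symmetric[OF e])
    show "eta e p *v (eta e p *v x) = x" by (rule eta_involution[OF e])
    show "(eta e p ** J) *v (transpose (eta e p ** J) *v x) = \<rho>\<^sup>2 *\<^sub>R x"
      unfolding T matrix_vector_mul_assoc[symmetric]
      by (simp only: vec.neg JJ matrix_vector_mult_scaleR eta_involution[OF e] scaleR_minus_left minus_minus)
    show "transpose (eta e p ** J) *v ((eta e p ** J) *v x) = \<rho>\<^sup>2 *\<^sub>R x"
      unfolding T matrix_vector_mul_assoc[symmetric] eta_involution[OF e]
      by (simp only: JJ scaleR_minus_left minus_minus)
    show "transpose (eta e p ** J) *v (eta e p *v x) = - (eta e p *v ((eta e p ** J) *v x))"
      unfolding T matrix_vector_mul_assoc[symmetric] eta_involution[OF e] by (rule refl)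
  qed
qed

section \<open>Geodesics in adapted coordinates\<close>

text \<open>
  \<open>X\<close> and \<open>Y\<close> are the coordinates of a curve and of its velocity in a basis adapted to the normal form.
\<close>

locale block_flow =
  fixes I :: "real set" and X Y :: "nat \<Rightarrow> real \<Rightarrow> real"
    and \<rho> :: real and s r \<kappa> :: nat and \<alpha> \<beta> :: "nat \<Rightarrow> real"
  assumes I: "is_interval I" "0 \<in> I"
    and X: "\<And>a \<tau>. a < 2 * r + 4 * \<kappa> \<Longrightarrow> \<tau> \<in> I \<Longrightarrow> (X a has_real_derivative Y a \<tau>) (at \<tau>)"
    and Y: "\<And>a \<tau>. a < 2 * r + 4 * \<kappa> \<Longrightarrow> \<tau> \<in> I \<Longrightarrow>
      (Y a has_real_derivative (\<Sum>b<2 * r + 4 * \<kappa>. block_entry \<rho> s r \<alpha> \<beta> a b *\<^sub>R Y b \<tau>)) (at \<tau>)"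
    and X0: "\<And>a. a < 2 * r + 4 * \<kappa> \<Longrightarrow> X a 0 = 0"
    and \<rho>: "\<rho> > 0" and sr: "s \<le> r" and ab: "\<And>k. k < \<kappa> \<Longrightarrow> (\<alpha> k)\<^sup>2 + (\<beta> k)\<^sup>2 = \<rho>\<^sup>2"
begin

lemma two_block_derivative:
  assumes "i < r" "\<tau> \<in> I"
  shows "(Y (2 * i) has_real_derivative \<rho> * Y (2 * i + 1) \<tau>) (at \<tau>)"
    and "(Y (2 * i + 1) has_real_derivative (if i < s then \<rho> else - \<rho>) * Y (2 * i) \<tau>) (at \<tau>)"
proof -
  have i: "2 * i + 0 < 2 * r + 4 * \<kappa>" "2 * i + 1 < 2 * r + 4 * \<kappa>" using assms(1) by linarith+
  have N: "2 * r \<le> 2 * r + 4 * \<kappa>" and k: "0 < (2::nat)" "1 < (2::nat)" by simp_all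
  show "(Y (2 * i) has_real_derivative \<rho> * Y (2 * i + 1) \<tau>) (at \<tau>)"
    using Y[OF i(1) assms(2)] unfolding block_entry_two_row[OF assms(1) N k(1)]
    by simp
  show "(Y (2 * i + 1) has_real_derivative (if i < s then \<rho> else - \<rho>) * Y (2 * i) \<tau>) (at \<tau>)"
    using Y[OF i(2) assms(2)] unfolding block_entry_two_row[OF assms(1) N k(2)]
    by simp
qed

lemma four_block_derivative:
  assumes "k < \<kappa>" "\<tau> \<in> I" "l < 4"
  shows "(Y (2 * r + 4 * k + l) has_real_derivative
     [\<alpha> k * Y (2 * r + 4 * k) \<tau> + \<beta> k * Y (2 * r + 4 * k + 1) \<tau>,
      - \<beta> k * Y (2 * r + 4 * k) \<tau> + \<alpha> k * Y (2 * r + 4 * k + 1) \<tau>,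
      - \<alpha> k * Y (2 * r + 4 * k + 2) \<tau> - \<beta> k * Y (2 * r + 4 * k + 3) \<tau>,
      \<beta> k * Y (2 * r + 4 * k + 2) \<tau> - \<alpha> k * Y (2 * r + 4 * k + 3) \<tau>] ! l) (at \<tau>)"
proof -
  have "2 * r + 4 * k + l < 2 * r + 4 * \<kappa>" using assms by linarith
  from Y[OF this assms(2)] show ?thesis
    unfolding block_entry_four_row[OF assms(1,3)] by (simp only: real_scaleR_def)
qed

lemma hyperbolic_coordinates:
  assumes t: "t \<in> I" and i: "i < s"
  shows "X (2 * i) t = 1 / \<rho> * (Y (2 * i) 0 * sinh (\<rho> * t) + Y (2 * i + 1) 0 * cosh (\<rho> * t) - Y (2 * i + 1) 0)
      \<and> X (2 * i + 1) t = 1 / \<rho> * (Y (2 * i + 1) 0 * sinh (\<rho> * t) + Y (2 * i) 0 * cosh (\<rho> * t) - Y (2 * i) 0)"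
  using two_block_derivative[of i] i sr by (intro hyperbolic_block_solution[OF I t _ _ _ _ _ _ \<rho>] X X0) auto

lemma elliptic_coordinates:
  assumes t: "t \<in> I" and i: "s \<le> i" "i < r"
  shows "X (2 * i) t = 1 / \<rho> * (Y (2 * i) 0 * sin (\<rho> * t) - Y (2 * i + 1) 0 * cos (\<rho> * t) + Y (2 * i + 1) 0)
      \<and> X (2 * i + 1) t = 1 / \<rho> * (Y (2 * i + 1) 0 * sin (\<rho> * t) + Y (2 * i) 0 * cos (\<rho> * t) - Y (2 * i) 0)"
  using two_block_derivative[of i] i by (intro elliptic_block_solution[OF I t _ _ _ _ _ _ \<rho>] X X0) auto

lemma spiral_out_coordinates:
  assumes t: "t \<in> I" and k: "k < \<kappa>" and a: "a = 1 / \<rho>\<^sup>2 * (\<alpha> k * Y (2 * r + 4 * k + 1) 0 + \<beta> k * Y (2 * r + 4 * k) 0)"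
      and b: "b = 1 / \<rho>\<^sup>2 * (\<alpha> k * Y (2 * r + 4 * k) 0 - \<beta> k * Y (2 * r + 4 * k + 1) 0)"
  shows "X (2 * r + 4 * k) t = a * sinh (\<alpha> k * t) * sin (\<beta> k * t) + b * cosh (\<alpha> k * t) * cos (\<beta> k * t)
            + b * sinh (\<alpha> k * t) * cos (\<beta> k * t) + a * cosh (\<alpha> k * t) * sin (\<beta> k * t) - b
      \<and> X (2 * r + 4 * k + 1) t = - b * sinh (\<alpha> k * t) * sin (\<beta> k * t) + a * cosh (\<alpha> k * t) * cos (\<beta> k * t)
            + a * sinh (\<alpha> k * t) * cos (\<beta> k * t) - b * cosh (\<alpha> k * t) * sin (\<beta> k * t) - a"
proof -
  have "X (2 * r + 4 * k) t = exp (\<alpha> k * t) * (b * cos (\<beta> k * t) + a * sin (\<beta> k * t)) - b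
     \<and> X (2 * r + 4 * k + 1) t = exp (\<alpha> k * t) * (a * cos (\<beta> k * t) - b * sin (\<beta> k * t)) - a"
  proof (rule spiral_block_solution[OF I t _ _ _ _ _ _ \<rho>])
    have lt: "2 * r + 4 * k < 2 * r + 4 * \<kappa>" "2 * r + 4 * k + 1 < 2 * r + 4 * \<kappa>" using k by linarith+
    show "X (2 * r + 4 * k) 0 = 0" "X (2 * r + 4 * k + 1) 0 = 0" using lt by (auto intro: X0)
    show "(\<alpha> k)\<^sup>2 + (\<beta> k)\<^sup>2 = \<rho>\<^sup>2" by (rule ab[OF k])
    show "a = 1 / \<rho>\<^sup>2 * (\<alpha> k * Y (2 * r + 4 * k + 1) 0 + \<beta> k * Y (2 * r + 4 * k) 0)"
      "b = 1 / \<rho>\<^sup>2 * (\<alpha> k * Y (2 * r + 4 * k) 0 - \<beta> k * Y (2 * r + 4 * k + 1) 0)" by (rule a b)+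
    fix \<tau> assume \<tau>: "\<tau> \<in> I"
    show "(X (2 * r + 4 * k) has_real_derivative Y (2 * r + 4 * k) \<tau>) (at \<tau>)"
      "(X (2 * r + 4 * k + 1) has_real_derivative Y (2 * r + 4 * k + 1) \<tau>) (at \<tau>)"
      using lt \<tau> by (auto intro: X)
    show "(Y (2 * r + 4 * k) has_real_derivative
        \<alpha> k * Y (2 * r + 4 * k) \<tau> + \<beta> k * Y (2 * r + 4 * k + 1) \<tau>) (at \<tau>)"
      using four_block_derivative[OF k \<tau>, of 0] by simp
    show "(Y (2 * r + 4 * k + 1) has_real_derivative
        - \<beta> k * Y (2 * r + 4 * k) \<tau> + \<alpha> k * Y (2 * r + 4 * k + 1) \<tau>) (at \<tau>)"
      using four_block_derivative[OF k \<tau>, of 1] by simp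
  qed
  moreover have "exp (\<alpha> k * t) = sinh (\<alpha> k * t) + cosh (\<alpha> k * t)" by (simp add: sinh_plus_cosh)
  ultimately show ?thesis by (simp only:) (simp add: algebra_simps)
qed

text \<open>
  The lower half of a block of size four is the upper half with \<open>\<alpha>\<close> and \<open>\<beta>\<close> negated. This negates both constants
  and turns \<open>exp\<close> into \<open>cosh - sinh\<close>, whence the changed signs in the formulas.
\<close>

lemma spiral_in_coordinates:
  assumes t: "t \<in> I" and k: "k < \<kappa>" and c: "c = 1 / \<rho>\<^sup>2 * (\<alpha> k * Y (2 * r + 4 * k + 3) 0 + \<beta> k * Y (2 * r + 4 * k + 2) 0)"
      and d: "d = 1 / \<rho>\<^sup>2 * (\<alpha> k * Y (2 * r + 4 * k + 2) 0 - \<beta> k * Y (2 * r + 4 * k + 3) 0)"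
  shows "X (2 * r + 4 * k + 2) t = - c * sinh (\<alpha> k * t) * sin (\<beta> k * t) - d * cosh (\<alpha> k * t) * cos (\<beta> k * t)
            + d * sinh (\<alpha> k * t) * cos (\<beta> k * t) + c * cosh (\<alpha> k * t) * sin (\<beta> k * t) + d
      \<and> X (2 * r + 4 * k + 3) t = d * sinh (\<alpha> k * t) * sin (\<beta> k * t) - c * cosh (\<alpha> k * t) * cos (\<beta> k * t)
            + c * sinh (\<alpha> k * t) * cos (\<beta> k * t) - d * cosh (\<alpha> k * t) * sin (\<beta> k * t) + c"
proof -
  have "X (2 * r + 4 * k + 2) t = exp (- \<alpha> k * t) * (- d * cos (- \<beta> k * t) + - c * sin (- \<beta> k * t)) - - d
     \<and> X (2 * r + 4 * k + 3) t = exp (- \<alpha> k * t) * (- c * cos (- \<beta> k * t) - - d * sin (- \<beta> k * t)) - - c"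
  proof (rule spiral_block_solution[OF I t _ _ _ _ _ _ \<rho>])
    have lt: "2 * r + 4 * k + 2 < 2 * r + 4 * \<kappa>" "2 * r + 4 * k + 3 < 2 * r + 4 * \<kappa>" using k by linarith+
    show "X (2 * r + 4 * k + 2) 0 = 0" "X (2 * r + 4 * k + 3) 0 = 0" using lt by (auto intro: X0)
    show "(- \<alpha> k)\<^sup>2 + (- \<beta> k)\<^sup>2 = \<rho>\<^sup>2" using ab[OF k] by simp
    show "- c = 1 / \<rho>\<^sup>2 * (- \<alpha> k * Y (2 * r + 4 * k + 3) 0 + - \<beta> k * Y (2 * r + 4 * k + 2) 0)"
      "- d = 1 / \<rho>\<^sup>2 * (- \<alpha> k * Y (2 * r + 4 * k + 2) 0 - - \<beta> k * Y (2 * r + 4 * k + 3) 0)"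
      by (simp_all add: c d algebra_simps)
    fix \<tau> assume \<tau>: "\<tau> \<in> I"
    show "(X (2 * r + 4 * k + 2) has_real_derivative Y (2 * r + 4 * k + 2) \<tau>) (at \<tau>)"
      "(X (2 * r + 4 * k + 3) has_real_derivative Y (2 * r + 4 * k + 3) \<tau>) (at \<tau>)"
      using lt \<tau> by (auto intro: X)
    show "(Y (2 * r + 4 * k + 2) has_real_derivative
        - \<alpha> k * Y (2 * r + 4 * k + 2) \<tau> + - \<beta> k * Y (2 * r + 4 * k + 3) \<tau>) (at \<tau>)"
      using four_block_derivative[OF k \<tau>, of 2] by simp
    show "(Y (2 * r + 4 * k + 3) has_real_derivative
        - (- \<beta> k) * Y (2 * r + 4 * k + 2) \<tau> + - \<alpha> k * Y (2 * r + 4 * k + 3) \<tau>) (at \<tau>)"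
      using four_block_derivative[OF k \<tau>, of 3] by simp
  qed
  moreover have "exp (- \<alpha> k * t) = cosh (\<alpha> k * t) - sinh (\<alpha> k * t)" by (simp add: cosh_minus_sinh)
  ultimately show ?thesis by (simp only:) (simp add: algebra_simps)
qed

end

section \<open>The Levi-Civita connection and the equations of motion\<close>

locale semi_H_type_group =
  fixes e :: "nat \<Rightarrow> 'n::finite" and p :: nat
    and ipU :: "real^'m::finite \<Rightarrow> real^'m \<Rightarrow> real" and j :: "real^'m \<Rightarrow> real^'n^'n"
  assumes H: "semi_H_type e p ipU j"
begin

abbreviation bracket :: "real^'n \<Rightarrow> real^'n \<Rightarrow> real^'m" where
  "bracket \<equiv> bracketV e p ipU j"

abbreviation metric :: "(real^'n) \<times> (real^'m) \<Rightarrow> (real^'n) \<times> (real^'m) \<Rightarrow> (real^'n) \<times> (real^'m) \<Rightarrow> real" where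
  "metric \<equiv> left_inv_metric e p ipU j"

lemma enumeration_e: "enumeration e" using H by (simp add: semi_H_type_def)

lemma ipU_sym: "ipU x y = ipU y x" and ipU_pos: "x \<noteq> 0 \<Longrightarrow> ipU x x > 0"
  using H by (auto simp: semi_H_type_def pos_def_inner_product_def)

lemma lin_j: "linear j" and j_square: "j u ** j u = - (ipU u u) *\<^sub>R mat 1"
  using H by (auto simp: semi_H_type_def)

sublocale ipU: bounded_bilinear ipU
  using H by (simp add: semi_H_type_def pos_def_inner_product_def bilinear_conv_bounded_bilinear)

lemma ipV_eta: "ipV e p (eta e p *v x) y = y \<bullet> x"
  by (simp add: ipV_def eta_involution[OF enumeration_e])

sublocale ipV: bounded_bilinear "ipV e p"
proof -
  have "bilinear (ipV e p)"
    unfolding bilinear_def ipV_def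
    by (auto intro!: linearI simp: inner_add matrix_vector_right_distrib matrix_vector_mult_scaleR)
  then show "bounded_bilinear (ipV e p)" by (simp add: bilinear_conv_bounded_bilinear)
qed

lemma ipV_sym: "ipV e p x y = ipV e p y x"
  by (metis ipV_def eta_symmetric[OF enumeration_e] inner_commute)

lemma j_skew: "(j u *v x) \<bullet> y = - (x \<bullet> (j u *v y))"
proof -
  have "ipV e p (eta e p *v (j u *v x)) y = - ipV e p x (eta e p *v (j u *v y))"
    using H unfolding semi_H_type_def by blast
  then show ?thesis
    by (metis ipV_eta ipV_sym inner_commute)
qed

lemma transpose_j: "transpose (j u) = - j u"
proof -
  have "transpose (j u) *v x = (- j u) *v x" for x
  proof (rule vector_eq_rdot[THEN iffD1], rule allI)
    show "(transpose (j u) *v x) \<bullet> y = ((- j u) *v x) \<bullet> y" for y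
      by (simp add: transpose_matrix_vector dot_lmul_matrix j_skew minus_matrix_vector_mult)
  qed
  then show ?thesis by (simp add: matrix_eq)
qed

lemma ipU_nondegenerate: "(\<And>u. ipU u x = ipU u y) \<Longrightarrow> x = y"
  using ipU_pos[of "x - y"] by (metis ipU.diff_right diff_self less_irrefl right_minus_eq)

text \<open>
  Finite-dimensional Riesz representation for \<open>ipU\<close>, which is positive definite but is not the standard inner
  product: the map sending \<open>z\<close> to the values of \<open>ipU _ z\<close> on the standard basis is injective, hence surjective.
\<close>

lemma ipU_representation:
  assumes "linear \<phi>"
  obtains z where "\<And>u. ipU u z = \<phi> u"
proof -
  define T where "T z = (\<Sum>b\<in>Basis. ipU b z *\<^sub>R b)" for z
  have T: "T z \<bullet> b = ipU b z" if "b \<in> Basis" for z b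
    using that by (simp add: T_def inner_sum_left_Basis)
  have lin: "linear T"
    by (rule linearI) (simp_all add: T_def ipU.add_right ipU.scaleR_right scaleR_add_left
        sum.distrib scaleR_sum_right)
  have lin_ipU: "linear (\<lambda>u. ipU u z)" for z
    by (rule bounded_linear.linear[OF ipU.bounded_linear_left])
  have "inj T"
  proof (rule injI)
    fix x y assume "T x = T y"
    then have "ipU b x = ipU b y" if "b \<in> Basis" for b using T that by metis
    then have "(\<lambda>u. ipU u x) = (\<lambda>u. ipU u y)" by (rule linear_eq_stdbasis[OF lin_ipU lin_ipU])
    then show "x = y" by (metis ipU_nondegenerate)
  qed
  then have "surj T" using linear_injective_imp_surjective[OF lin] by simp
  then obtain z where "T z = (\<Sum>b\<in>Basis. \<phi> b *\<^sub>R b)" by (metis surjD)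
  then have "ipU b z = \<phi> b" if "b \<in> Basis" for b
    using T[OF that, of z] that by (simp add: inner_sum_left_Basis)
  then have "(\<lambda>u. ipU u z) = \<phi>" by (rule linear_eq_stdbasis[OF lin_ipU assms])
  then show thesis using that by metis
qed

lemma ipU_bracket: "ipU u (bracket x y) = y \<bullet> (j u *v x)"
proof -
  interpret j: linear j by (rule lin_j)
  have "linear (\<lambda>u. y \<bullet> (j u *v x))"
    by (rule linearI) (simp_all add: j.add j.scaleR matrix_vector_mult_add_rdistrib inner_add
        scaleR_matrix_vector_assoc[symmetric])
  then obtain z where z: "\<And>u. ipU u z = y \<bullet> (j u *v x)" by (rule ipU_representation) blast
  have "bracket x y = z"
    unfolding bracketV_def ipV_eta
    by (rule the_equality) (use z ipU_nondegenerate in auto)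
  then show ?thesis by (simp add: z)
qed

sublocale bracket: bounded_bilinear bracket
proof -
  have "bilinear bracket"
    unfolding bilinear_def
    by (intro conjI allI linearI; rule ipU_nondegenerate;
        simp add: ipU_bracket ipU.add_right ipU.scaleR_right inner_add_left inner_add_right
        matrix_vector_right_distrib matrix_vector_mult_scaleR)
  then show "bounded_bilinear bracket" by (simp add: bilinear_conv_bounded_bilinear)
qed

lemma bracket_skew: "bracket x y = - bracket y x"
  by (rule ipU_nondegenerate) (metis ipU_bracket ipU.minus_right j_skew inner_commute)

lemma bracket_self [simp]: "bracket x x = 0"
  by (rule ipU_nondegenerate) (use j_skew[of _ x x] in \<open>simp add: ipU_bracket inner_commute ipU.zero_right\<close>)

text \<open>
  The \<open>U\<close>-component of a tangent vector at \<open>x\<close> after left translation to the identity.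
\<close>

definition vertical :: "(real^'n) \<times> (real^'m) \<Rightarrow> (real^'n) \<times> (real^'m) \<Rightarrow> real^'m" where
  "vertical x X = snd X - (1/2) *\<^sub>R bracket (fst x) (fst X)"

lemma left_translation: "left_translation_to_identity e p ipU j x X = (fst X, vertical x X)"
proof -
  have "(group_mult e p ipU j (- x) has_derivative (\<lambda>X. (fst X, vertical x X))) (at x)"
    unfolding group_mult_def[abs_def] vertical_def
    by (auto intro!: derivative_eq_intros bracket.FDERIV simp: bracket.minus_left bracket.zero_left)
  then show ?thesis
    unfolding left_translation_to_identity_def by (simp only: frechet_derivative_at[symmetric])
qed

lemma metric_eq:
  "metric x X Y = ipV e p (fst X) (fst Y) + ipU (vertical x X) (vertical x Y)"
  by (simp add: left_inv_metric_def left_translation)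

lemma metric_sym: "metric x X Y = metric x Y X"
  by (simp add: metric_eq ipV_sym ipU_sym)

lemma vertical_linear:
    "vertical x (- X) = - vertical x X" "vertical x (X - Y) = vertical x X - vertical x Y"
    "vertical x 0 = 0"
  by (simp_all add: vertical_def bracket.add_right bracket.minus_right bracket.diff_right bracket.zero_right algebra_simps)

lemma metric_linear: "metric x (- X) Y = - metric x X Y" "metric x (X - Y) Z = metric x X Z - metric x Y Z"
    "metric x 0 Y = 0"
  by (simp_all add: metric_eq vertical_linear ipU.minus_left ipV.minus_left ipU.diff_left ipV.diff_left
      ipU.zero_left ipV.zero_left)

lemma metric_nondegenerate:
  assumes "\<And>Z. metric x X Z = 0" shows "X = 0"
proof -
  have "ipU d (vertical x X) = ipU d 0" for d
  proof -
    have "vertical x (0, d) = d" by (simp add: vertical_def bracket.zero_right)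
    then have "ipU (vertical x X) d = 0" using assms[of "(0, d)"] by (simp add: metric_eq ipV.zero_right)
    then show ?thesis by (metis ipU_sym ipU.zero_right)
  qed
  then have v: "vertical x X = 0" by (rule ipU_nondegenerate)
  have "z \<bullet> (eta e p *v fst X) = z \<bullet> 0" for z
    using assms[of "(z, 0)"] by (simp add: metric_eq v ipU.zero_left ipV_def)
  then have "eta e p *v fst X = 0" by (metis vector_eq_ldot)
  then have "fst X = 0" using eta_involution[OF enumeration_e, of p "fst X"] by simp
  then show ?thesis using v by (simp add: vertical_def bracket.zero_right prod_eq_iff)
qed

lemma metric_has_derivative:
  assumes Z: "(Z has_derivative Z') (at x)"
  shows "((\<lambda>y. metric y c (Z y)) has_derivative
    (\<lambda>h. metric x c (Z' h) - (1/2) * (ipU (bracket (fst h) (fst c)) (vertical x (Z x))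
        + ipU (vertical x c) (bracket (fst h) (fst (Z x)))))) (at x)"
proof -
  have fst: "((\<lambda>y. fst (Z y)) has_derivative (\<lambda>h. fst (Z' h))) (at x)"
    and snd: "((\<lambda>y. snd (Z y)) has_derivative (\<lambda>h. snd (Z' h))) (at x)"
    using Z by (auto intro: has_derivative_fst has_derivative_snd)
  have vZ: "((\<lambda>y. vertical y (Z y)) has_derivative
      (\<lambda>h. vertical x (Z' h) - (1/2) *\<^sub>R bracket (fst h) (fst (Z x)))) (at x)"
    unfolding vertical_def
    by (rule derivative_eq_intros bracket.FDERIV fst snd refl)+ (simp add: algebra_simps)
  have vc: "((\<lambda>y. vertical y c) has_derivative (\<lambda>h. - (1/2) *\<^sub>R bracket (fst h) (fst c))) (at x)"
    unfolding vertical_def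
    by (rule derivative_eq_intros bracket.FDERIV refl)+ (simp add: bracket.zero_right)
  show ?thesis
    unfolding metric_eq
    by (rule has_derivative_eq_rhs[OF has_derivative_add[OF ipV.FDERIV[OF has_derivative_const fst] ipU.FDERIV[OF vc vZ]]])
      (simp add: fun_eq_iff ipV.zero_left ipU.diff_right ipU.minus_left ipU.scaleR_left ipU.scaleR_right algebra_simps)
qed

text \<open>
  All terms containing the derivative of \<open>Z\<close> cancel, so that only the derivatives of the metric remain. The
  two derivatives in direction \<open>c\<close> together contribute as much as the one in direction \<open>Z\<close>, because half of each
  of them contains the bracket of \<open>c\<close> with itself.
\<close>

lemma koszul_constant:
  assumes Z: "Z differentiable (at x)"
  shows "koszul metric (\<lambda>_. c) (\<lambda>_. c) Z x = - 2 * (fst (Z x) \<bullet> (j (vertical x c) *v fst c))"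
proof -
  define Z' where "Z' = frechet_derivative Z (at x)"
  have Z': "(Z has_derivative Z') (at x)" unfolding Z'_def using Z frechet_derivative_works by blast
  let ?w = "vertical x c"
  have d1: "frechet_derivative (\<lambda>y. metric y c (Z y)) (at x) c = metric x c (Z' c) - (1/2) * ipU ?w (bracket (fst c) (fst (Z x)))"
    unfolding frechet_derivative_at[OF metric_has_derivative[OF Z'], symmetric] by (simp add: ipU.zero_left)
  have d2: "frechet_derivative (\<lambda>y. metric y c c) (at x) (Z x) = ipU ?w (bracket (fst c) (fst (Z x)))"
    unfolding frechet_derivative_at[OF metric_has_derivative[OF has_derivative_const], symmetric]
    by (simp add: metric_sym[of x c] metric_linear ipU_sym[of _ ?w] bracket_skew[of "fst c"] ipU.minus_right)
  have const: "frechet_derivative (\<lambda>_. c) (at x) = (\<lambda>_. 0)"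
    using frechet_derivative_at[OF has_derivative_const] by metis
  have vf: "vf_bracket (\<lambda>_. c) (\<lambda>_. c) x = 0" "vf_bracket (\<lambda>_. c) Z x = Z' c" "vf_bracket Z (\<lambda>_. c) x = - Z' c"
    by (simp_all add: vf_bracket_def const Z'_def)
  have sym: "(\<lambda>y. metric y (Z y) c) = (\<lambda>y. metric y c (Z y))" by (simp add: metric_sym)
  show ?thesis
    unfolding koszul_def sym d1 d2 vf
    by (simp add: metric_linear metric_sym[of x "Z' c"] ipU_bracket)
qed

text \<open>
  The vector on the right has vanishing vertical part, so it pairs with \<open>Z\<close> only through \<open>V\<close>, and there it represents
  the Koszul functional. Nondegeneracy of the metric makes it the only such vector.
\<close>

lemma levi_civita_constant:
  "levi_civita metric (\<lambda>_. c) (\<lambda>_. c) x =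
     (let a = - (eta e p *v (j (vertical x c) *v fst c)) in (a, (1/2) *\<^sub>R bracket (fst x) a))"
proof -
  define a where "a = - (eta e p *v (j (vertical x c) *v fst c))"
  define W where "W = (a, (1/2) *\<^sub>R bracket (fst x) a)"
  have ga: "metric x W Z = - (fst Z \<bullet> (j (vertical x c) *v fst c))" for Z
  proof -
    have "vertical x W = 0" by (simp add: vertical_def W_def)
    then show ?thesis
      by (simp add: metric_eq ipU.zero_left W_def a_def ipV.minus_left ipV_eta)
  qed
  have "levi_civita metric (\<lambda>_. c) (\<lambda>_. c) x = W"
    unfolding levi_civita_def
  proof (rule the_equality)
    show "\<forall>Z. (\<forall>y. Z differentiable at y) \<longrightarrow> 2 * metric x W (Z x) = koszul metric (\<lambda>_. c) (\<lambda>_. c) Z x"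
    proof (intro allI impI)
      fix Z :: "(real^'n) \<times> (real^'m) \<Rightarrow> (real^'n) \<times> (real^'m)"
      assume "\<forall>y. Z differentiable at y"
      then have "koszul metric (\<lambda>_. c) (\<lambda>_. c) Z x = - 2 * (fst (Z x) \<bullet> (j (vertical x c) *v fst c))"
        by (intro koszul_constant) blast
      then show "2 * metric x W (Z x) = koszul metric (\<lambda>_. c) (\<lambda>_. c) Z x" by (simp only: ga)
    qed
  next
    fix W' assume W': "\<forall>Z. (\<forall>y. Z differentiable at y) \<longrightarrow> 2 * metric x W' (Z x) = koszul metric (\<lambda>_. c) (\<lambda>_. c) Z x"
    have "metric x (W' - W) z = 0" for z
      using W'[rule_format, of "\<lambda>_. z"] by (simp add: metric_linear ga koszul_constant)
    then show "W' = W" using metric_nondegenerate by (metis right_minus_eq)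
  qed
  then show ?thesis by (simp add: W_def a_def Let_def)
qed

text \<open>
  The \<open>U\<close>-component of the geodesic equation says that \<open>u'' = [v, v'']/2\<close>, so the vertical part
  \<open>w = u' - [v, v']/2\<close> of the velocity has derivative \<open>- [v', v']/2 = 0\<close>. Its constant value \<open>u0\<close>
  can then be inserted in the \<open>V\<close>-component \<open>v'' = \<eta> j(w) v'\<close>.
\<close>

lemma geodesic_equations:
  assumes I: "open I" "is_interval I" "0 \<in> I"
    and geodesic: "geodesic_on metric I (\<lambda>t. (v t, u t))"
    and start: "(v 0, u 0) = (0, 0)"
    and velocity: "vector_derivative (\<lambda>t. (v t, u t)) (at 0) = (v0, u0)"
    and t: "t \<in> I"
  shows "(v has_vector_derivative vector_derivative v (at t)) (at t)"
    and "(u has_vector_derivative vector_derivative u (at t)) (at t)"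
    and "((\<lambda>s. vector_derivative v (at s)) has_vector_derivative
          (eta e p ** j u0) *v vector_derivative v (at t)) (at t)"
    and "vector_derivative u (at t) + (1/2) *\<^sub>R bracket (vector_derivative v (at t)) (v t) = u0"
    and "vector_derivative v (at 0) = v0"
proof -
  define c where "c t = (v t, u t)" for t
  define c' where "c' = (\<lambda>t. vector_derivative c (at t))"
  define V U where "V t = vector_derivative v (at t)" and "U t = vector_derivative u (at t)" for t
  define w where "w t = U t - (1/2) *\<^sub>R bracket (v t) (V t)" for t
  have c: "(c has_vector_derivative c' s) (at s)" "c' differentiable (at s)"
    "covariant_derivative_along metric c c' s = 0" if "s \<in> I" for s
    using geodesic that unfolding geodesic_on_def c_def[symmetric, abs_def] c'_def[symmetric]
    by (auto simp: vector_derivative_works fun_cong[OF c'_def])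
  have v': "(v has_vector_derivative fst (c' s)) (at s)" if "s \<in> I" for s
    using bounded_linear.has_vector_derivative[OF bounded_linear_fst c(1)[OF that]] by (simp add: c_def)
  have u': "(u has_vector_derivative snd (c' s)) (at s)" if "s \<in> I" for s
    using bounded_linear.has_vector_derivative[OF bounded_linear_snd c(1)[OF that]] by (simp add: c_def)
  have c'_eq: "c' s = (V s, U s)" if "s \<in> I" for s
    using vector_derivative_at[OF v'[OF that]] vector_derivative_at[OF u'[OF that]]
    by (simp add: V_def U_def prod_eq_iff)
  have dv: "(v has_vector_derivative V s) (at s)" and du: "(u has_vector_derivative U s) (at s)" if "s \<in> I" for s
    using v' u' c'_eq that by fastforce+
  have second: "(V has_vector_derivative eta e p *v (j (w s) *v V s)) (at s)"
    "(U has_vector_derivative (1/2) *\<^sub>R bracket (v s) (eta e p *v (j (w s) *v V s))) (at s)" if s: "s \<in> I" for s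
  proof -
    define a where "a = eta e p *v (j (w s) *v V s)"
    have w: "vertical (c s) (c' s) = w s" by (simp add: vertical_def c_def c'_eq[OF s] w_def)
    have "vector_derivative c' (at s) = - levi_civita metric (\<lambda>_. c' s) (\<lambda>_. c' s) (c s)"
      using c(3)[OF s] unfolding covariant_derivative_along_def fun_cong[OF c'_def, symmetric]
      by (simp add: eq_neg_iff_add_eq_0)
    also have "\<dots> = (a, (1/2) *\<^sub>R bracket (v s) a)"
      unfolding levi_civita_constant Let_def w
      by (simp add: a_def c'_eq[OF s] bracket.minus_right) (simp add: c_def)
    finally have dc': "(c' has_vector_derivative (a, (1/2) *\<^sub>R bracket (v s) a)) (at s)"
      using c(2)[OF s] vector_derivative_works by metis
    show "(V has_vector_derivative eta e p *v (j (w s) *v V s)) (at s)"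
      using has_vector_derivative_transform_within_open[OF bounded_linear.has_vector_derivative[OF bounded_linear_fst dc'] I(1) s, of V]
      by (simp add: c'_eq a_def)
    show "(U has_vector_derivative (1/2) *\<^sub>R bracket (v s) (eta e p *v (j (w s) *v V s))) (at s)"
      using has_vector_derivative_transform_within_open[OF bounded_linear.has_vector_derivative[OF bounded_linear_snd dc'] I(1) s, of U]
      by (simp add: c'_eq a_def)
  qed
  have "(w has_vector_derivative 0) (at s)" if s: "s \<in> I" for s
    unfolding w_def
    using has_vector_derivative_diff[OF second(2)[OF s]
        bounded_linear.has_vector_derivative[OF bounded_linear_scaleR_right
          bracket.has_vector_derivative[OF dv[OF s] second(1)[OF s]], of "1/2"]]
    by simp
  then have "\<exists>k. \<forall>s\<in>I. w s = k"
    using has_vector_derivative_zero_constant[of I w] I(2)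
    by (metis has_vector_derivative_at_within is_interval_convex)
  moreover have c0: "c' 0 = (v0, u0)" using velocity by (simp add: c'_def c_def[abs_def])
  then have "V 0 = v0" "w 0 = u0" using c'_eq[OF I(3)] start by (simp_all add: w_def bracket.zero_left)
  ultimately have w: "w s = u0" if "s \<in> I" for s using I(3) that by metis
  show "(v has_vector_derivative vector_derivative v (at t)) (at t)"
    "(u has_vector_derivative vector_derivative u (at t)) (at t)"
    using dv[OF t] du[OF t] by (simp_all add: V_def U_def)
  show "((\<lambda>s. vector_derivative v (at s)) has_vector_derivative
          (eta e p ** j u0) *v vector_derivative v (at t)) (at t)"
    using second(1)[OF t] by (simp add: w[OF t] V_def[abs_def] matrix_vector_mul_assoc)
  show "vector_derivative u (at t) + (1/2) *\<^sub>R bracket (vector_derivative v (at t)) (v t) = u0"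
    using w[OF t] bracket_skew[of "V t" "v t"] by (simp add: w_def V_def U_def)
  show "vector_derivative v (at 0) = v0" using \<open>V 0 = v0\<close> by (simp add: V_def)
qed

end

section \<open>Explicit geodesics\<close>

theorem mainTheorem1:
  fixes e :: "nat \<Rightarrow> 'n::finite"
    and p :: nat
    and ipU :: "real^'m::finite \<Rightarrow> real^'m \<Rightarrow> real"
    and j :: "real^'m \<Rightarrow> real^'n^'n"
    and v :: "real \<Rightarrow> real^'n"
    and u :: "real \<Rightarrow> real^'m"
    and I :: "real set"
    and v0 :: "real^'n"
    and u0 :: "real^'m"
    and A :: "real^'n^'n"
    and \<rho> :: real
  assumes H: "semi_H_type e p ipU j"
    and I: "open I" "is_interval I" "0 \<in> I"
    and geodesic: "geodesic_on (left_inv_metric e p ipU j) I (\<lambda>t. (v t, u t))"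
    and start: "(v 0, u 0) = (0, 0)"
    and velocity: "vector_derivative (\<lambda>t. (v t, u t)) (at 0) = (v0, u0)"
    and u0: "u0 \<noteq> 0"
    and A: "A = eta e p ** j u0"
    and \<rho>: "\<rho> = sqrt (ipU u0 u0)"
  shows
    "(\<forall>t\<in>I.
        ((\<lambda>s. vector_derivative v (at s)) has_vector_derivative
            A *v vector_derivative v (at t)) (at t)
      \<and> vector_derivative u (at t)
          + (1/2) *\<^sub>R bracketV e p ipU j (vector_derivative v (at t)) (v t) = u0)
   \<and> (\<exists>s r \<kappa> :: nat. \<exists>\<alpha> \<beta> :: nat \<Rightarrow> real. \<exists>P :: real^'n^'n.
        s \<le> r \<and> 2 * r + 4 * \<kappa> = CARD('n)
      \<and> (\<forall>k<\<kappa>. (\<alpha> k)\<^sup>2 + (\<beta> k)\<^sup>2 = \<rho>\<^sup>2)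
      \<and> orthogonal_matrix P
      \<and> A = P ** matrix_of e (block_entry \<rho> s r \<alpha> \<beta>) ** matrix_inv P
      \<and> (let x = (\<lambda>a t. (matrix_inv P *v v t) $ e a);
             x0 = (\<lambda>a. (matrix_inv P *v v0) $ e a)
         in
           (\<forall>t\<in>I. \<forall>i<s.
              (let i1 = 2 * i; i2 = 2 * i + 1 in
                 x i1 t = 1 / \<rho> * (x0 i1 * sinh (\<rho> * t) + x0 i2 * cosh (\<rho> * t) - x0 i2)
               \<and> x i2 t = 1 / \<rho> * (x0 i2 * sinh (\<rho> * t) + x0 i1 * cosh (\<rho> * t) - x0 i1)))
         \<and> (\<forall>t\<in>I. \<forall>i\<in>{s..<r}.
              (let i1 = 2 * i; i2 = 2 * i + 1 in
                 x i1 t = 1 / \<rho> * (x0 i1 * sin (\<rho> * t) - x0 i2 * cos (\<rho> * t) + x0 i2)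
               \<and> x i2 t = 1 / \<rho> * (x0 i2 * sin (\<rho> * t) + x0 i1 * cos (\<rho> * t) - x0 i1)))
         \<and> (\<forall>t\<in>I. \<forall>k<\<kappa>.
              (let k1 = 2 * r + 4 * k; k2 = 2 * r + 4 * k + 1;
                   Ak = 1 / \<rho>\<^sup>2 * (\<alpha> k * x0 k2 + \<beta> k * x0 k1);
                   Bk = 1 / \<rho>\<^sup>2 * (\<alpha> k * x0 k1 - \<beta> k * x0 k2) in
                 x k1 t =
                     Ak * sinh (\<alpha> k * t) * sin (\<beta> k * t) + Bk * cosh (\<alpha> k * t) * cos (\<beta> k * t)
                   + Bk * sinh (\<alpha> k * t) * cos (\<beta> k * t) + Ak * cosh (\<alpha> k * t) * sin (\<beta> k * t)
                   - Bk
               \<and> x k2 t =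
                   - Bk * sinh (\<alpha> k * t) * sin (\<beta> k * t) + Ak * cosh (\<alpha> k * t) * cos (\<beta> k * t)
                   + Ak * sinh (\<alpha> k * t) * cos (\<beta> k * t) - Bk * cosh (\<alpha> k * t) * sin (\<beta> k * t)
                   - Ak))
         \<and> (\<forall>t\<in>I. \<forall>k<\<kappa>.
              (let k3 = 2 * r + 4 * k + 2; k4 = 2 * r + 4 * k + 3;
                   Ck = 1 / \<rho>\<^sup>2 * (\<alpha> k * x0 k4 + \<beta> k * x0 k3);
                   Dk = 1 / \<rho>\<^sup>2 * (\<alpha> k * x0 k3 - \<beta> k * x0 k4) in
                 x k3 t =
                   - Ck * sinh (\<alpha> k * t) * sin (\<beta> k * t) - Dk * cosh (\<alpha> k * t) * cos (\<beta> k * t)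
                   + Dk * sinh (\<alpha> k * t) * cos (\<beta> k * t) + Ck * cosh (\<alpha> k * t) * sin (\<beta> k * t)
                   + Dk
               \<and> x k4 t =
                     Dk * sinh (\<alpha> k * t) * sin (\<beta> k * t) - Ck * cosh (\<alpha> k * t) * cos (\<beta> k * t)
                   + Ck * sinh (\<alpha> k * t) * cos (\<beta> k * t) - Dk * cosh (\<alpha> k * t) * sin (\<beta> k * t)
                   + Ck)))
      \<and> (\<forall>t\<in>I. v t = P *v (matrix_inv P *v v t)
            \<and> u t = t *\<^sub>R u0
                - (1/2) *\<^sub>R (LBINT \<tau>=0..t. bracketV e p ipU j (vector_derivative v (at \<tau>)) (v \<tau>))))"
proof -
  interpret G: semi_H_type_group e p ipU j by unfold_locales (rule H)
  have \<rho>_pos: "\<rho> > 0" and \<rho>2: "\<rho>\<^sup>2 = ipU u0 u0" using G.ipU_pos[OF u0] by (simp_all add: \<rho>)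
  note geo = G.geodesic_equations[OF I geodesic start velocity, folded A]
  define V where "V t = vector_derivative v (at t)" for t
  have v: "(v has_vector_derivative V t) (at t)" if "t \<in> I" for t
    using geo(1)[OF that] by (simp add: V_def)
  have V: "(V has_vector_derivative A *v V t) (at t)" if "t \<in> I" for t
    using geo(3)[OF that] by (simp add: V_def[abs_def])
  have V0: "V 0 = v0" using geo(5)[OF I(3)] by (simp add: V_def)
  interpret T: twisted_conformal "\<lambda>x. transpose A *v x" "\<lambda>x. A *v x" "\<lambda>x. eta e p *v x" \<rho>
    unfolding A by (rule twisted_conformal_matrix[OF G.enumeration_e G.transpose_j _ \<rho>_pos]) (simp only: \<rho>2 G.j_square)
  obtain s r \<kappa> :: nat and \<alpha> \<beta> :: "nat \<Rightarrow> real" and c :: "nat \<Rightarrow> real^'n" where sr: "s \<le> r"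
    and N: "2 * r + 4 * \<kappa> = DIM(real^'n)" and ab: "\<And>k. k < \<kappa> \<Longrightarrow> (\<alpha> k)\<^sup>2 + (\<beta> k)\<^sup>2 = \<rho>\<^sup>2"
    and on: "\<And>a b. a < DIM(real^'n) \<Longrightarrow> b < DIM(real^'n) \<Longrightarrow> c a \<bullet> c b = (if a = b then 1 else 0)"
    and rows: "\<And>a. a < DIM(real^'n) \<Longrightarrow>
      transpose A *v c a = (\<Sum>b<DIM(real^'n). block_entry \<rho> s r \<alpha> \<beta> a b *\<^sub>R c b)"
    using T.orthonormal_block_basis by blast
  have DIM: "DIM(real^'n) = CARD('n)" by simp
  note N = N[unfolded DIM] and on = on[unfolded DIM] and rows = rows[unfolded DIM]
  have row: "c a \<bullet> (A *v z) = (\<Sum>b<CARD('n). block_entry \<rho> s r \<alpha> \<beta> a b * (c b \<bullet> z))" if "a < CARD('n)" for a z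
    using T.adj[of "c a" z] rows[OF that] by (simp add: inner_sum_left)
  obtain P :: "real^'n^'n" where P: "orthogonal_matrix P"
    and coord: "\<And>a x. a < CARD('n) \<Longrightarrow> (matrix_inv P *v x) $ e a = c a \<bullet> x"
    using orthonormal_enumerated_columns[OF G.enumeration_e on] by blast
  have PP: "P ** matrix_inv P = mat 1" "matrix_inv P ** P = mat 1"
    using P by (simp_all add: orthogonal_matrix_inv orthogonal_matrix_def)
  let ?D = "matrix_of e (block_entry \<rho> s r \<alpha> \<beta>)"
  \<comment> \<open>Row by row, \<open>P\<^sup>t A = D P\<^sup>t\<close>.\<close>
  have "matrix_inv P *v (A *v z) = ?D *v (matrix_inv P *v z)" for z
    by (rule enumeration_vec_eqI[OF G.enumeration_e]) (simp add: coord row matrix_of_vector[OF G.enumeration_e])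
  then have "matrix_inv P ** A = ?D ** matrix_inv P" by (simp add: matrix_eq flip: matrix_vector_mul_assoc)
  then have normal: "A = P ** ?D ** matrix_inv P"
    by (metis PP(1) matrix_mul_assoc matrix_mul_lid)
  have X: "((\<lambda>t. c a \<bullet> v t) has_real_derivative c a \<bullet> V t) (at t)" if "t \<in> I" for a t
    using bounded_linear.has_vector_derivative[OF bounded_linear_inner_right v[OF that]]
    by (simp add: has_real_derivative_iff_has_vector_derivative)
  have Y: "((\<lambda>t. c a \<bullet> V t) has_real_derivative
      (\<Sum>b<2 * r + 4 * \<kappa>. block_entry \<rho> s r \<alpha> \<beta> a b *\<^sub>R (c b \<bullet> V t))) (at t)"
    if "a < 2 * r + 4 * \<kappa>" "t \<in> I" for a t
    using bounded_linear.has_vector_derivative[OF bounded_linear_inner_right V[OF that(2)], of "c a"] that(1)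
    by (simp add: has_real_derivative_iff_has_vector_derivative row N)
  have X0: "c a \<bullet> v 0 = 0" for a using start by simp
  interpret F: block_flow I "\<lambda>a t. c a \<bullet> v t" "\<lambda>a t. c a \<bullet> V t" \<rho> s r \<kappa> \<alpha> \<beta>
    by unfold_locales (use I X Y X0 \<rho>_pos sr ab in auto)
  have integral: "u t = t *\<^sub>R u0
      - (1/2) *\<^sub>R (LBINT \<tau>=0..t. bracketV e p ipU j (vector_derivative v (at \<tau>)) (v \<tau>))" if t: "t \<in> I" for t
  proof -
    have seg: "\<tau> \<in> I" if "min 0 t \<le> \<tau>" "\<tau> \<le> max 0 t" for \<tau>
      using that I(2,3) t unfolding is_interval_1 by (metis max_def min_def)
    have "(LBINT \<tau>=ereal 0..ereal t. G.bracket (V \<tau>) (v \<tau>)) = (- 2) *\<^sub>R (u t - t *\<^sub>R u0) - (- 2) *\<^sub>R (u 0 - 0 *\<^sub>R u0)"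
    proof (rule interval_integral_FTC_finite)
      show "continuous_on {min 0 t..max 0 t} (\<lambda>\<tau>. G.bracket (V \<tau>) (v \<tau>))"
      proof (rule continuous_at_imp_continuous_on, rule ballI)
        fix \<tau> assume "\<tau> \<in> {min 0 t..max 0 t}"
        then have \<tau>: "\<tau> \<in> I" using seg by simp
        show "isCont (\<lambda>\<tau>. G.bracket (V \<tau>) (v \<tau>)) \<tau>"
          by (rule has_vector_derivative_continuous[OF G.bracket.has_vector_derivative[OF V[OF \<tau>] v[OF \<tau>]]])
      qed
      fix \<tau> assume "min 0 t \<le> \<tau>" "\<tau> \<le> max 0 t"
      then have \<tau>: "\<tau> \<in> I" using seg by simp
      have eq: "G.bracket (V \<tau>) (v \<tau>) = (- 2) *\<^sub>R (vector_derivative u (at \<tau>) - u0)"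
        unfolding geo(4)[OF \<tau>, symmetric] by (simp add: V_def)
      have "((\<lambda>\<tau>. (- 2) *\<^sub>R (u \<tau> - \<tau> *\<^sub>R u0)) has_vector_derivative G.bracket (V \<tau>) (v \<tau>)) (at \<tau>)"
        unfolding eq by (auto intro!: derivative_eq_intros geo(2)[OF \<tau>])
      then show "((\<lambda>\<tau>. (- 2) *\<^sub>R (u \<tau> - \<tau> *\<^sub>R u0)) has_vector_derivative G.bracket (V \<tau>) (v \<tau>))
          (at \<tau> within {min 0 t..max 0 t})" by (rule has_vector_derivative_at_within)
    qed
    then have eq: "(LBINT \<tau>=0..t. G.bracket (vector_derivative v (at \<tau>)) (v \<tau>)) = (- 2) *\<^sub>R (u t - t *\<^sub>R u0)"
      using start by (simp add: V_def zero_ereal_def)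
    show ?thesis unfolding eq by simp
  qed
  have lt2: "2 * i < CARD('n)" "2 * i + 1 < CARD('n)" if "i < r" for i
    using that N by linarith+
  have lt4: "2 * r + 4 * k < CARD('n)" "2 * r + 4 * k + 1 < CARD('n)" "2 * r + 4 * k + 2 < CARD('n)"
    "2 * r + 4 * k + 3 < CARD('n)" if "k < \<kappa>" for k
    using that N by linarith+
  show ?thesis
  proof (rule conjI, use geo(3,4) in blast, rule exI[of _ s], rule exI[of _ r], rule exI[of _ \<kappa>],
      rule exI[of _ \<alpha>], rule exI[of _ \<beta>], rule exI[of _ P], intro conjI, goal_cases)
    case 6
    show ?case
      unfolding Let_def
    proof (intro conjI ballI allI impI, goal_cases)
      case (1 t i)
      then have "i < r" using sr by simp
      then show ?case using F.hyperbolic_coordinates[OF 1] by (simp only: V0 coord[OF lt2(1)] coord[OF lt2(2)])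
    next
      case (2 t i)
      then have "i < r" using sr by simp
      then show ?case using F.hyperbolic_coordinates[OF 2] by (simp only: V0 coord[OF lt2(1)] coord[OF lt2(2)])
    next
      case (3 t i)
      then have "s \<le> i" "i < r" by simp_all
      then show ?case using F.elliptic_coordinates[OF 3(1), of i] by (simp only: V0 coord[OF lt2(1)] coord[OF lt2(2)])
    next
      case (4 t i)
      then have "s \<le> i" "i < r" by simp_all
      then show ?case using F.elliptic_coordinates[OF 4(1), of i] by (simp only: V0 coord[OF lt2(1)] coord[OF lt2(2)])
    next
      case (5 t k)
      then show ?case using F.spiral_out_coordinates[OF 5 refl refl] by (simp only: V0 coord[OF lt4(1)] coord[OF lt4(2)])
    next
      case (6 t k)
      then show ?case using F.spiral_out_coordinates[OF 6 refl refl] by (simp only: V0 coord[OF lt4(1)] coord[OF lt4(2)])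
    next
      case (7 t k)
      then show ?case using F.spiral_in_coordinates[OF 7 refl refl] by (simp only: V0 coord[OF lt4(3)] coord[OF lt4(4)])
    next
      case (8 t k)
      then show ?case using F.spiral_in_coordinates[OF 8 refl refl] by (simp only: V0 coord[OF lt4(3)] coord[OF lt4(4)])
    qed
  next
    case 7
    show ?case using integral by (simp add: matrix_vector_mul_assoc PP)
  qed (use sr N ab P normal in simp_all)
qed

end
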